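(* There exist absolute constants $\varepsilon_0>0$ and $C_{\mathrm{lin}}<\infty$ such that, for all sufficiently large $n$ and all $1\le k\le\varepsilon_0 n$, the half-lazy kernel $Q_{n,k}=\frac12(I+P_{n,k})$ satisfies $\tau_{\mathrm{mix}}(Q_{n,k})\le C_{\mathrm{lin}}\,nk\log n$.
   Context: Let $V=\mathbb F_2^k$ and $\mathrm{St}(n,k)=\{(z_1,\dots,z_n)\in V^n:\operatorname{span}(z_1,\dots,z_n)=V\}$. The kernel $P_{n,k}$ on $\mathrm{St}(n,k)$: choose an ordered pair $(a,b)$ of distinct indices in $\{1,\dots,n\}$ uniformly at random and replace $z_b$ by $z_b+z_a$. Its stationary law $\pi$ is uniform on $\mathrm{St}(n,k)$. $\tau_{\mathrm{mix}}(Q)=\min\{t\ge0:\max_x\|Q^t(x,\cdot)-\pi\|_{\mathrm{TV}}\le1/4\}$. *)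

theory Defs
  imports Complex_Main
begin

text \<open>Vectors of V = F_2^k are bool lists of length k; addition is componentwise xor.
  A state (z_1,...,z_n) is a list of n such vectors.\<close>

definition vecs :: "nat \<Rightarrow> bool list set" where
  "vecs k = {v. length v = k}"

definition vadd :: "bool list \<Rightarrow> bool list \<Rightarrow> bool list" where
  "vadd u v = map2 (\<noteq>) u v"

definition lincomb :: "nat \<Rightarrow> bool list \<Rightarrow> bool list list \<Rightarrow> bool list" where
  "lincomb k cs zs = foldr (\<lambda>(c, z) acc. if c then vadd z acc else acc) (zip cs zs) (replicate k False)"

definition span2 :: "nat \<Rightarrow> bool list list \<Rightarrow> bool list set" where
  "span2 k zs = {lincomb k cs zs | cs. length cs = length zs}"

definition St :: "nat \<Rightarrow> nat \<Rightarrow> bool list list set" where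
  "St n k = {zs. length zs = n \<and> (\<forall>z\<in>set zs. length z = k) \<and> span2 k zs = vecs k}"

definition step :: "bool list list \<Rightarrow> nat \<Rightarrow> nat \<Rightarrow> bool list list" where
  "step zs a b = zs[b := vadd (zs ! b) (zs ! a)]"

definition Pker :: "nat \<Rightarrow> bool list list \<Rightarrow> bool list list \<Rightarrow> real" where
  "Pker n x y = real (card {(a, b). a < n \<and> b < n \<and> a \<noteq> b \<and> step x a b = y}) / real (n * (n - 1))"

definition Qker :: "nat \<Rightarrow> bool list list \<Rightarrow> bool list list \<Rightarrow> real" where
  "Qker n x y = ((if x = y then 1 else 0) + Pker n x y) / 2"

fun Qpow :: "nat \<Rightarrow> nat \<Rightarrow> nat \<Rightarrow> bool list list \<Rightarrow> bool list list \<Rightarrow> real" where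
  "Qpow n k 0 x y = (if x = y then 1 else 0)"
| "Qpow n k (Suc t) x y = (\<Sum>w\<in>St n k. Qpow n k t x w * Qker n w y)"

definition piU :: "nat \<Rightarrow> nat \<Rightarrow> bool list list \<Rightarrow> real" where
  "piU n k y = 1 / real (card (St n k))"

definition tv_dist :: "nat \<Rightarrow> nat \<Rightarrow> nat \<Rightarrow> bool list list \<Rightarrow> real" where
  "tv_dist n k t x = (1/2) * (\<Sum>y\<in>St n k. \<bar>Qpow n k t x y - piU n k y\<bar>)"

definition mixed :: "nat \<Rightarrow> nat \<Rightarrow> nat \<Rightarrow> bool" where
  "mixed n k t \<longleftrightarrow> (\<forall>x\<in>St n k. tv_dist n k t x \<le> 1/4)"

definition tau_mix :: "nat \<Rightarrow> nat \<Rightarrow> nat" where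
  "tau_mix n k = (LEAST t. mixed n k t)"

end

theory Submission
  imports Defs "HOL-Real_Asymp.Real_Asymp"
begin

text \<open>
  The proof is an entropy decay argument on the full product space (F_2^k)^n, in which
  St(n,k) is invariant. Let D be the relative entropy of the law at time t with respect to the
  uniform law on the product space. Because the kernel is half lazy, one step lowers D by at
  least a constant times the Dirichlet form of the square root of the density. Fix all coordinates
  but the b-th one: the moves into b form a random walk on the Cayley graph of F_2^k generated
  by the other coordinates, which by Fourier analysis has a spectral gap of constant order
  as soon as every nonzero linear functional is nonzero on a constant fraction of the coordinates.
  The logarithmic Sobolev inequality for the complete graph on 2^k points turns this
  variance bound into an entropy bound at the cost of a factor of order k, and tensorization of
  entropy sums over b. Hence D decays at rate of order 1/(nk) up to the contribution of the
  unbalanced states, and it starts below nk, so that a time of order nk log(nk) suffices.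

  The number of coordinates on which a fixed functional is nonzero is a birth-and-death
  chain; a Lyapunov function shows that it is below n/12 with probability exponentially small
  in k + log n after time of order n (k + log n). A union bound over the 2^k functionals is
  affordable for k at most a small multiple of n. At the end, D bounds the squared Hellinger
  distance to the uniform law on St(n,k), since the latter set is a subset of the product space.
\<close>

section \<open>Entropy on finite sets\<close>

text \<open>From \<open>ln z <= z - 1\<close> at \<open>z = sqrt (A / u)\<close>. The surplus over
  the tangent line of \<open>u * ln u\<close> at \<open>A\<close> is a squared Hellinger term; it
  supplies both the Dirichlet form and the final Hellinger bound.\<close>

lemma entropy_tangent:
  fixes u A :: real
  assumes "u \<ge> 0" "A > 0"
  shows "u - A + (sqrt u - sqrt A)\<^sup>2 \<le> u * ln u - u * ln A"
proof (cases "u = 0")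
  case True
  then show ?thesis using assms by simp
next
  case False
  with assms have u: "u > 0" by simp
  have "ln (sqrt (A / u)) \<le> sqrt (A / u) - 1"
    using u assms by (intro ln_le_minus_one) simp
  then have "(ln A - ln u) / 2 \<le> sqrt A / sqrt u - 1"
    using u assms by (simp add: ln_sqrt ln_div real_sqrt_divide diff_divide_distrib)
  then have "u * ((ln A - ln u) / 2) \<le> u * (sqrt A / sqrt u - 1)"
    using u by (intro mult_left_mono) auto
  also have "\<dots> = sqrt u * sqrt A - u"
    using u by (simp add: field_simps)
  finally have "u * ln A - u * ln u \<le> 2 * (sqrt u * sqrt A) - 2 * u"
    by (simp add: right_diff_distrib)
  then show ?thesis
    using u assms by (simp add: power2_diff)
qed

lemma entropy_tangent_weak:
  fixes u A :: real
  assumes "u \<ge> 0" "A > 0"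
  shows "u - A \<le> u * ln u - u * ln A"
  using entropy_tangent[OF assms] zero_le_power2[of "sqrt u - sqrt A"] by linarith

text \<open>The total mass of \<open>g\<close> times the relative entropy of the normalised \<open>g\<close>
  with respect to the uniform law on \<open>S\<close>; the value of \<open>ln 0\<close> is irrelevant.\<close>

definition uent :: "'a set \<Rightarrow> ('a \<Rightarrow> real) \<Rightarrow> real" where
  "uent S g = (\<Sum>x\<in>S. g x * ln (g x)) - sum g S * (ln (sum g S) - ln (real (card S)))"

text \<open>Nonnegativity of mutual information: \<open>f i x\<close> is compared with the product
  of its marginals, \<open>s x * G i / T\<close>. Both have total mass \<open>T\<close>, so the
  linear terms of the tangent bound cancel on summation.\<close>

lemma uent_subadditive:
  assumes "finite A" "finite I" and nn: "\<And>i x. i \<in> I \<Longrightarrow> x \<in> A \<Longrightarrow> f i x \<ge> 0"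
  shows "uent A (\<lambda>x. \<Sum>i\<in>I. f i x) \<le> (\<Sum>i\<in>I. uent A (f i))"
proof -
  define G where "G i = (\<Sum>x\<in>A. f i x)" for i
  define s where "s x = (\<Sum>i\<in>I. f i x)" for x
  define T where "T = (\<Sum>i\<in>I. G i)"
  have T': "T = (\<Sum>x\<in>A. s x)"
    unfolding T_def G_def s_def by (rule sum.swap)
  have pt: "f i x - s x * G i / T \<le> f i x * (ln (f i x) - ln (s x) - ln (G i) + ln T)"
    if i: "i \<in> I" and x: "x \<in> A" for i x
  proof (cases "f i x = 0")
    case True
    have "0 \<le> s x" "0 \<le> G i" "0 \<le> T"
      unfolding s_def G_def T_def using nn i x by (auto intro!: sum_nonneg)
    then show ?thesis using True by simp
  next
    case False
    then have f0: "f i x > 0" using nn[OF i x] by simp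
    have "f i x \<le> s x" unfolding s_def by (rule member_le_sum) (use i x nn assms in auto)
    moreover have "f i x \<le> G i" unfolding G_def by (rule member_le_sum) (use i x nn assms in auto)
    moreover have "G i \<le> T" unfolding T_def
      by (rule member_le_sum) (use i nn assms in \<open>auto simp: G_def intro!: sum_nonneg\<close>)
    ultimately have pos: "s x > 0" "G i > 0" "T > 0" using f0 by linarith+
    have "f i x - s x * G i / T \<le> f i x * ln (f i x) - f i x * ln (s x * G i / T)"
      by (rule entropy_tangent_weak) (use f0 pos in auto)
    then show ?thesis using pos by (simp add: ln_div ln_mult algebra_simps)
  qed
  have "(\<Sum>i\<in>I. \<Sum>x\<in>A. f i x - s x * G i / T) = T - (\<Sum>i\<in>I. \<Sum>x\<in>A. s x * G i / T)"
    unfolding sum_subtractf by (simp add: T_def G_def)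
  also have "(\<Sum>i\<in>I. \<Sum>x\<in>A. s x * G i / T) = (\<Sum>i\<in>I. (\<Sum>x\<in>A. s x) * (G i / T))"
    by (simp only: sum_distrib_right sum_divide_distrib times_divide_eq_right)
  also have "\<dots> = T * (T / T)"
    by (simp only: T'[symmetric] sum_distrib_left[symmetric] sum_divide_distrib[symmetric] T_def[symmetric])
  finally have "0 = (\<Sum>i\<in>I. \<Sum>x\<in>A. f i x - s x * G i / T)" by simp
  also have "\<dots> \<le> (\<Sum>i\<in>I. \<Sum>x\<in>A. f i x * (ln (f i x) - ln (s x) - ln (G i) + ln T))"
    by (intro sum_mono pt)
  also have "\<dots> = (\<Sum>i\<in>I. \<Sum>x\<in>A. f i x * ln (f i x)) - (\<Sum>i\<in>I. \<Sum>x\<in>A. f i x * ln (s x))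
      - (\<Sum>i\<in>I. G i * ln (G i)) + T * ln T"
    by (simp add: algebra_simps sum.distrib sum_subtractf T_def G_def sum_distrib_right sum_distrib_left)
  also have "(\<Sum>i\<in>I. \<Sum>x\<in>A. f i x * ln (s x)) = (\<Sum>x\<in>A. s x * ln (s x))"
    by (subst sum.swap) (simp add: s_def sum_distrib_right)
  finally show ?thesis
    unfolding uent_def s_def[symmetric] G_def[symmetric] T'[symmetric]
    by (simp add: sum_subtractf right_diff_distrib sum_distrib_right[symmetric] T_def[symmetric])
qed

text \<open>Each value is at most the total mass, so a point mass is the worst case.\<close>

lemma uent_le:
  assumes "finite A" "A \<noteq> {}" and nn: "\<And>x. x \<in> A \<Longrightarrow> g x \<ge> 0"
  shows "uent A g \<le> sum g A * ln (real (card A))"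
proof -
  have "g x * ln (g x) \<le> g x * ln (sum g A)" if x: "x \<in> A" for x
  proof (cases "g x = 0")
    case False
    then have "g x > 0" using nn[OF x] by simp
    moreover have "g x \<le> sum g A" by (rule member_le_sum) (use x nn assms in auto)
    ultimately show ?thesis by (intro mult_left_mono) auto
  qed simp
  then have "(\<Sum>x\<in>A. g x * ln (g x)) \<le> (\<Sum>x\<in>A. g x * ln (sum g A))" by (rule sum_mono)
  then show ?thesis unfolding uent_def by (simp add: sum_distrib_right algebra_simps)
qed

subsection \<open>Tensorization\<close>

definition tuples :: "'a set \<Rightarrow> nat \<Rightarrow> 'a list set" where
  "tuples A n = {xs. set xs \<subseteq> A \<and> length xs = n}"

lemma finite_tuples: "finite A \<Longrightarrow> finite (tuples A n)"
  unfolding tuples_def by (rule finite_lists_length_eq)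

lemma card_tuples: "finite A \<Longrightarrow> card (tuples A n) = card A ^ n"
  unfolding tuples_def by (rule card_lists_length_eq)

lemma sum_tuples_Suc:
  "(\<Sum>xs\<in>tuples A (Suc n). F xs) = (\<Sum>x\<in>A. \<Sum>xs\<in>tuples A n. F (x # xs))"
proof -
  have "(\<Sum>xs\<in>tuples A (Suc n). F xs) = (\<Sum>(x, xs)\<in>A \<times> tuples A n. F (x # xs))"
    by (rule sum.reindex_bij_witness[of _ "\<lambda>(x, xs). x # xs" "\<lambda>xs. (hd xs, tl xs)"])
      (auto simp: tuples_def length_Suc_conv)
  then show ?thesis by (simp add: sum.cartesian_product)
qed

text \<open>Induction by the chain rule on the first coordinate: conditional entropies go to the
  induction hypothesis, the marginal \<open>F\<close> to subadditivity. The factor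
  \<open>card A\<close> arises because the right side counts each fibre once for every value of the
  b-th entry.\<close>

lemma uent_tensorization:
  assumes "finite A" "A \<noteq> {}" and "\<And>xs. xs \<in> tuples A n \<Longrightarrow> f xs \<ge> 0"
  shows "real (card A) * uent (tuples A n) f
    \<le> (\<Sum>b<n. \<Sum>xs\<in>tuples A n. uent A (\<lambda>v. f (xs[b := v])))"
  using assms(3)
proof (induction n arbitrary: f)
  case 0
  have "tuples A 0 = {[]}" by (auto simp: tuples_def)
  then show ?case by (simp add: uent_def)
next
  case (Suc n)
  let ?N = "real (card A)"
  have N: "?N > 0" using assms by (simp add: card_gt_0_iff)
  have nn: "f (x # xs) \<ge> 0" if "x \<in> A" "xs \<in> tuples A n" for x xs
    using Suc.prems[of "x # xs"] that by (auto simp: tuples_def)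
  define F where "F x = (\<Sum>xs\<in>tuples A n. f (x # xs))" for x
  have chain: "uent (tuples A (Suc n)) f
      = (\<Sum>x\<in>A. uent (tuples A n) (\<lambda>xs. f (x # xs))) + uent A F"
    unfolding uent_def sum_tuples_Suc F_def[symmetric] card_tuples[OF assms(1)]
    using N by (simp add: sum_subtractf right_diff_distrib sum_distrib_right[symmetric] ln_mult)
      (simp add: algebra_simps)
  have "uent A F \<le> (\<Sum>xs\<in>tuples A n. uent A (\<lambda>x. f (x # xs)))"
    unfolding F_def by (rule uent_subadditive) (use assms finite_tuples nn in auto)
  then have "?N * uent A F \<le> (\<Sum>x\<in>A. \<Sum>xs\<in>tuples A n. uent A (\<lambda>v. f ((x # xs)[0 := v])))"
    using N by simp
  moreover have "?N * (\<Sum>x\<in>A. uent (tuples A n) (\<lambda>xs. f (x # xs)))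
      \<le> (\<Sum>x\<in>A. \<Sum>b<n. \<Sum>xs\<in>tuples A n. uent A (\<lambda>v. f (x # xs[b := v])))"
    unfolding sum_distrib_left by (intro sum_mono Suc.IH nn)
  moreover have "(\<Sum>x\<in>A. \<Sum>b<n. \<Sum>xs\<in>tuples A n. uent A (\<lambda>v. f (x # xs[b := v])))
      = (\<Sum>b<n. \<Sum>x\<in>A. \<Sum>xs\<in>tuples A n. uent A (\<lambda>v. f ((x # xs)[Suc b := v])))"
    by (subst sum.swap) simp
  ultimately show ?case
    unfolding chain sum.lessThan_Suc_shift sum_tuples_Suc
    by (simp add: distrib_left)
qed

text \<open>Exchanging \<open>v\<close> with the b-th entry of \<open>y\<close> is an involution on
  the pairs \<open>(y, v)\<close>.\<close>

lemma sum_tuples_resample: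
  assumes b: "b < n"
  shows "(\<Sum>y\<in>tuples A n. \<Sum>v\<in>A. F (y[b := v])) = real (card A) * (\<Sum>y\<in>tuples A n. F y)"
proof -
  have "(\<Sum>y\<in>tuples A n. \<Sum>v\<in>A. F (y[b := v])) = (\<Sum>(y, v)\<in>tuples A n \<times> A. F (y[b := v]))"
    by (simp add: sum.cartesian_product)
  also have "\<dots> = (\<Sum>(y, v)\<in>tuples A n \<times> A. F y)"
    by (rule sum.reindex_bij_witness[of _ "\<lambda>(y, v). (y[b := v], y ! b)" "\<lambda>(y, v). (y[b := v], y ! b)"])
      (use b in \<open>auto simp: tuples_def dest!: set_update_subset_insert[THEN subsetD]\<close>)
  also have "\<dots> = real (card A) * (\<Sum>y\<in>tuples A n. F y)"
    by (simp add: sum.cartesian_product[symmetric] sum_distrib_left)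
  finally show ?thesis .
qed

subsection \<open>The logarithmic Sobolev inequality for the complete graph\<close>

text \<open>Near 1 both sides vanish to second order, and \<open>ln r <= r - 1\<close> suffices up
  to \<open>r = 2\<close>. Beyond that \<open>ln r <= ln N\<close> and
  \<open>r <= 2 * (r - 1)\<close>; only this range costs the logarithm of \<open>N\<close>.\<close>

lemma lsi_pointwise:
  fixes r N :: real
  assumes "0 \<le> r" "r \<le> N" "1 \<le> N"
  shows "r\<^sup>2 * ln (r\<^sup>2) - r\<^sup>2 + 1 \<le> (5 + 8 * ln N) * (r - 1)\<^sup>2"
proof -
  have lN: "ln N \<ge> 0" using assms by simp
  consider "r = 0" | "0 < r" "r \<le> 2" | "r > 2" using assms by linarith
  then show ?thesis
  proof cases
    case 1
    then show ?thesis using lN by simp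
  next
    case 2
    have "r\<^sup>2 * ln (r\<^sup>2) - r\<^sup>2 + 1 = 2 * r\<^sup>2 * ln r - r\<^sup>2 + 1"
      using 2 by (simp add: ln_realpow)
    also have "\<dots> \<le> 2 * r\<^sup>2 * (r - 1) - r\<^sup>2 + 1"
      using ln_le_minus_one[of r] 2 by (auto intro!: mult_left_mono)
    also have "\<dots> = (2 * r + 1) * (r - 1)\<^sup>2"
      by (simp add: power2_eq_square algebra_simps)
    also have "\<dots> \<le> (5 + 8 * ln N) * (r - 1)\<^sup>2"
      using 2 lN by (intro mult_right_mono) auto
    finally show ?thesis .
  next
    case 3
    have "r\<^sup>2 * ln (r\<^sup>2) - r\<^sup>2 + 1 = 2 * (r\<^sup>2 * ln r) - r\<^sup>2 + 1"
      using 3 by (simp add: ln_realpow)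
    also have "\<dots> \<le> 2 * (r\<^sup>2 * ln N)"
    proof -
      have "r\<^sup>2 * ln r \<le> r\<^sup>2 * ln N" using 3 assms by (intro mult_left_mono) auto
      moreover have "1 \<le> r\<^sup>2" using 3 by (simp add: one_le_power)
      ultimately show ?thesis by linarith
    qed
    also have "\<dots> \<le> 2 * (4 * (r - 1)\<^sup>2 * ln N)"
    proof -
      have "0 \<le> (r - 2) * (3 * r - 2)" using 3 by simp
      then have "r\<^sup>2 \<le> 4 * (r - 1)\<^sup>2" by (simp add: power2_eq_square algebra_simps)
      then show ?thesis using lN by (intro mult_left_mono mult_right_mono) auto
    qed
    also have "\<dots> \<le> (5 + 8 * ln N) * (r - 1)\<^sup>2"
      by (simp add: distrib_right)
    finally show ?thesis .
  qed
qed

text \<open>The pointwise bound is applied to \<open>h v / m\<close>, where \<open>m\<close> is the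
  mean of \<open>h\<close>; this ratio is at most \<open>N\<close> because \<open>h v\<close> is at
  most the sum of \<open>h\<close>.\<close>

lemma uent_square_le_variance:
  assumes fin: "finite A" and ne: "A \<noteq> {}" and nn: "\<And>v. v \<in> A \<Longrightarrow> h v \<ge> 0"
  shows "uent A (\<lambda>v. (h v)\<^sup>2)
    \<le> (5 + 8 * ln (real (card A))) * (\<Sum>v\<in>A. (h v - sum h A / real (card A))\<^sup>2)"
proof -
  define N where "N = real (card A)"
  define m where "m = sum h A / N"
  define S where "S = (\<Sum>v\<in>A. (h v)\<^sup>2)"
  have "card A \<ge> 1" using fin ne by (simp add: Suc_leI card_gt_0_iff)
  then have N: "N \<ge> 1" unfolding N_def by simp
  have m0: "m \<ge> 0" unfolding m_def using N nn by (simp add: sum_nonneg)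
  show ?thesis
  proof (cases "m = 0")
    case True
    then have "h v = 0" if "v \<in> A" for v
      using that nn fin N by (simp add: m_def sum_nonneg_eq_0_iff)
    then show ?thesis by (simp add: uent_def)
  next
    case False
    with m0 have m: "m > 0" by simp
    have hN: "h v \<le> N * m" if "v \<in> A" for v
    proof -
      have "h v \<le> sum h A" by (rule member_le_sum) (use that nn fin in auto)
      then show ?thesis using N by (simp add: m_def)
    qed
    \<comment> \<open>Variational form of entropy: the reference value \<open>m^2\<close> replaces
      the mean \<open>S / N\<close> of the squares, at the price of linear terms that make each
      summand the expression of \<open>lsi_pointwise\<close>.\<close>
    have "S - N * m\<^sup>2 \<le> S * ln S - S * ln (N * m\<^sup>2)"
      by (rule entropy_tangent_weak) (use m N in \<open>auto simp: S_def sum_nonneg\<close>)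
    then have "uent A (\<lambda>v. (h v)\<^sup>2) \<le> (\<Sum>v\<in>A. (h v)\<^sup>2 * ln ((h v)\<^sup>2)) - S * ln (m\<^sup>2) - S + N * m\<^sup>2"
      unfolding uent_def S_def[symmetric] N_def[symmetric]
      using m N by (simp add: ln_mult algebra_simps)
    also have "\<dots> = (\<Sum>v\<in>A. (h v)\<^sup>2 * ln ((h v)\<^sup>2) - (h v)\<^sup>2 * ln (m\<^sup>2) - (h v)\<^sup>2 + m\<^sup>2)"
      by (simp add: sum.distrib sum_subtractf S_def N_def sum_distrib_right)
    also have "\<dots> \<le> (\<Sum>v\<in>A. (5 + 8 * ln N) * (h v - m)\<^sup>2)"
    proof (rule sum_mono)
      fix v assume v: "v \<in> A"
      have "m\<^sup>2 * ((h v / m)\<^sup>2 * ln ((h v / m)\<^sup>2) - (h v / m)\<^sup>2 + 1)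
          \<le> m\<^sup>2 * ((5 + 8 * ln N) * (h v / m - 1)\<^sup>2)"
        using nn[OF v] hN[OF v] m N
        by (intro mult_left_mono lsi_pointwise) (auto simp: field_simps)
      also have "\<dots> = (5 + 8 * ln N) * (m * (h v / m - 1))\<^sup>2"
        by (simp add: power_mult_distrib)
      also have "m * (h v / m - 1) = h v - m" using m by (simp add: field_simps)
      also have "m\<^sup>2 * ((h v / m)\<^sup>2 * ln ((h v / m)\<^sup>2) - (h v / m)\<^sup>2 + 1)
          = (h v)\<^sup>2 * ln ((h v)\<^sup>2 / m\<^sup>2) - (h v)\<^sup>2 + m\<^sup>2"
        using m by (simp add: power_divide field_simps)
      also have "(h v)\<^sup>2 * ln ((h v)\<^sup>2 / m\<^sup>2) = (h v)\<^sup>2 * ln ((h v)\<^sup>2) - (h v)\<^sup>2 * ln (m\<^sup>2)"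
        using m by (cases "h v = 0") (auto simp: ln_div algebra_simps)
      finally show "(h v)\<^sup>2 * ln ((h v)\<^sup>2) - (h v)\<^sup>2 * ln (m\<^sup>2) - (h v)\<^sup>2 + m\<^sup>2
          \<le> (5 + 8 * ln N) * (h v - m)\<^sup>2" by simp
    qed
    finally show ?thesis by (simp add: sum_distrib_left m_def N_def)
  qed
qed

section \<open>Fourier analysis on binary vectors\<close>

lemma vadd_simps [simp]:
  "vadd [] v = []" "vadd u [] = []" "vadd (a # u) (b # v) = (a \<noteq> b) # vadd u v"
  by (simp_all add: vadd_def)

lemma length_vadd [simp]: "length (vadd u v) = min (length u) (length v)"
  by (simp add: vadd_def)

lemma vadd_commute: "vadd u v = vadd v u"
  by (induction u v rule: list_induct2') auto

lemma vadd_assoc: "vadd (vadd u v) w = vadd u (vadd v w)"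
proof (induction u arbitrary: v w)
  case (Cons a u)
  then show ?case by (cases v; cases w) auto
qed simp

lemma vadd_cancel [simp]: "length u = length v \<Longrightarrow> vadd (vadd u v) v = u"
  by (induction u v rule: list_induct2) auto

lemma vadd_zero: "length u = k \<Longrightarrow> vadd u (replicate k False) = u"
  by (induction u arbitrary: k) auto

lemma vecs_eq_tuples: "vecs k = tuples UNIV k"
  by (auto simp: vecs_def tuples_def)

lemma finite_vecs [simp]: "finite (vecs k)"
  by (simp add: vecs_eq_tuples finite_tuples)

lemma card_vecs [simp]: "card (vecs k) = 2 ^ k"
  by (simp add: vecs_eq_tuples card_tuples)

lemma vecs_nonempty [simp]: "vecs k \<noteq> {}"
  using card_vecs[of k] by (metis card.empty power_not_zero zero_neq_numeral)

lemma replicate_in_vecs [simp]: "replicate k c \<in> vecs k"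
  by (simp add: vecs_def)

lemma vadd_in_vecs [simp]: "u \<in> vecs k \<Longrightarrow> v \<in> vecs k \<Longrightarrow> vadd u v \<in> vecs k"
  by (simp add: vecs_def)

fun dot :: "bool list \<Rightarrow> bool list \<Rightarrow> bool" where
  "dot (a # u) (b # v) = ((a \<and> b) \<noteq> dot u v)"
| "dot _ _ = False"

lemma dot_vadd: "length v = length w \<Longrightarrow> dot u (vadd v w) = (dot u v \<noteq> dot u w)"
proof (induction u arbitrary: v w)
  case (Cons a u)
  then show ?case by (cases v; cases w) auto
qed simp

lemma dot_zero_left [simp]: "dot (replicate k False) v = False"
proof (induction k arbitrary: v)
  case (Suc k)
  then show ?case by (cases v) auto
qed simp

lemma dot_zero_right [simp]: "dot u (replicate k False) = False"
proof (induction k arbitrary: u)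
  case (Suc k)
  then show ?case by (cases u) auto
qed (cases u; simp)

lemma dot_nondegenerate:
  assumes "u \<in> vecs k" "u \<noteq> replicate k False"
  obtains v where "v \<in> vecs k" "dot u v"
proof -
  have "\<exists>v. length v = length u \<and> dot u v" if "u \<noteq> replicate (length u) False"
    using that
  proof (induction u)
    case (Cons a u)
    show ?case
    proof (cases a)
      case True
      then show ?thesis by (intro exI[of _ "True # replicate (length u) False"]) simp
    next
      case False
      with Cons obtain v where "length v = length u" "dot u v" by auto
      then show ?thesis by (intro exI[of _ "False # v"]) simp
    qed
  qed simp
  then show ?thesis using assms that by (auto simp: vecs_def)
qed

definition chi :: "bool list \<Rightarrow> bool list \<Rightarrow> real" where
  "chi u v = (if dot u v then -1 else 1)"

lemma chi_vadd: "length v = length w \<Longrightarrow> chi u (vadd v w) = chi u v * chi u w"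
  by (simp add: chi_def dot_vadd)

lemma sum_vecs_Suc:
  "(\<Sum>v\<in>vecs (Suc k). F v) = (\<Sum>v\<in>vecs k. F (False # v)) + (\<Sum>v\<in>vecs k. F (True # v))"
  unfolding vecs_eq_tuples sum_tuples_Suc by (simp add: UNIV_bool)

text \<open>The unnormalised Walsh-Hadamard transform; hence the factor \<open>2 ^ k\<close> in
  Parseval's identity.\<close>

definition fourier :: "nat \<Rightarrow> (bool list \<Rightarrow> real) \<Rightarrow> bool list \<Rightarrow> real" where
  "fourier k h u = (\<Sum>v\<in>vecs k. h v * chi u v)"

text \<open>Splitting off the first bit turns the transform into those of the sum and the difference
  of two halves; the parallelogram law gives a factor 2 per bit.\<close>

lemma parseval: "(\<Sum>u\<in>vecs k. (fourier k h u)\<^sup>2) = 2 ^ k * (\<Sum>v\<in>vecs k. (h v)\<^sup>2)"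
proof (induction k arbitrary: h)
  case 0
  have "vecs 0 = {[]}" by (auto simp: vecs_def)
  then show ?case by (simp add: fourier_def chi_def)
next
  case (Suc k)
  have "fourier (Suc k) h (False # u) = fourier k (\<lambda>v. h (False # v) + h (True # v)) u" for u
    by (simp add: fourier_def sum_vecs_Suc chi_def sum.distrib[symmetric] distrib_right)
  moreover have "fourier (Suc k) h (True # u) = fourier k (\<lambda>v. h (False # v) - h (True # v)) u" for u
    unfolding fourier_def sum_vecs_Suc sum.distrib[symmetric]
    by (rule sum.cong) (auto simp: chi_def)
  ultimately have "(\<Sum>u\<in>vecs (Suc k). (fourier (Suc k) h u)\<^sup>2)
      = 2 ^ k * (\<Sum>v\<in>vecs k. (h (False # v) + h (True # v))\<^sup>2 + (h (False # v) - h (True # v))\<^sup>2)"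
    by (simp add: sum_vecs_Suc Suc.IH sum.distrib distrib_left)
  also have "\<dots> = 2 ^ k * (\<Sum>v\<in>vecs k. 2 * ((h (False # v))\<^sup>2 + (h (True # v))\<^sup>2))"
    by (simp add: power2_eq_square algebra_simps)
  also have "\<dots> = 2 ^ Suc k * (\<Sum>v\<in>vecs (Suc k). (h v)\<^sup>2)"
    by (simp add: sum_vecs_Suc sum_distrib_left[symmetric] sum.distrib)
  finally show ?case .
qed

text \<open>Translation by \<open>s\<close> multiplies the coefficient at \<open>u\<close> by the
  character value \<open>chi u s\<close>.\<close>

lemma fourier_difference:
  assumes s: "s \<in> vecs k"
  shows "fourier k (\<lambda>v. h v - h (vadd v s)) u = fourier k h u * (1 - chi u s)"
proof -
  have "(\<Sum>v\<in>vecs k. h (vadd v s) * chi u v) = (\<Sum>v\<in>vecs k. h v * chi u (vadd v s))"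
    by (rule sum.reindex_bij_witness[of _ "\<lambda>v. vadd v s" "\<lambda>v. vadd v s"])
      (use s in \<open>auto simp: vecs_def\<close>)
  also have "\<dots> = (\<Sum>v\<in>vecs k. h v * chi u v) * chi u s"
    unfolding sum_distrib_right
    by (rule sum.cong) (use s in \<open>auto simp: vecs_def chi_vadd\<close>)
  finally show ?thesis
    by (simp add: fourier_def left_diff_distrib sum_subtractf right_diff_distrib)
qed

text \<open>Characters diagonalise all translations at once. A generator with
  \<open>dot u (s a)\<close> multiplies the energy at frequency \<open>u\<close> by 4, others by 0,
  and every nonzero frequency has at least \<open>m\<close> of the former. The zero frequency
  carries exactly the mean.\<close>

lemma poincare_cayley:
  assumes I: "finite I" "\<And>a. a \<in> I \<Longrightarrow> s a \<in> vecs k"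
    and gap: "\<And>u. u \<in> vecs k \<Longrightarrow> u \<noteq> replicate k False \<Longrightarrow> m \<le> card {a\<in>I. dot u (s a)}"
  shows "4 * real m * (\<Sum>v\<in>vecs k. (h v - sum h (vecs k) / 2 ^ k)\<^sup>2)
    \<le> (\<Sum>a\<in>I. \<Sum>v\<in>vecs k. (h v - h (vadd v (s a)))\<^sup>2)"
proof -
  let ?z = "replicate k False"
  have one: "2 ^ k * (\<Sum>v\<in>vecs k. (h v - h (vadd v (s a)))\<^sup>2)
      = (\<Sum>u\<in>vecs k. (fourier k h u)\<^sup>2 * (1 - chi u (s a))\<^sup>2)" if "a \<in> I" for a
    unfolding parseval[symmetric] by (simp add: fourier_difference I that power_mult_distrib)
  have cnt: "(\<Sum>a\<in>I. (1 - chi u (s a))\<^sup>2) = 4 * real (card {a\<in>I. dot u (s a)})" for u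
  proof -
    have "(\<Sum>a\<in>I. (1 - chi u (s a))\<^sup>2) = (\<Sum>a\<in>I. if dot u (s a) then 4 else 0)"
      by (rule sum.cong) (auto simp: chi_def)
    also have "\<dots> = 4 * real (card {a\<in>I. dot u (s a)})"
      using I(1) by (simp add: sum.inter_filter[symmetric])
    finally show ?thesis .
  qed
  have f0: "fourier k h ?z = sum h (vecs k)"
    by (simp add: fourier_def chi_def)
  have "2 ^ k * (4 * real m * (\<Sum>v\<in>vecs k. (h v - sum h (vecs k) / 2 ^ k)\<^sup>2))
      = 4 * real m * (2 ^ k * (\<Sum>v\<in>vecs k. (h v)\<^sup>2) - (sum h (vecs k))\<^sup>2)"
  proof -
    have ex: "(\<Sum>v\<in>vecs k. (h v - c)\<^sup>2)
        = (\<Sum>v\<in>vecs k. (h v)\<^sup>2) - 2 * sum h (vecs k) * c + 2 ^ k * c\<^sup>2" for c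
      by (simp add: power2_diff sum.distrib sum_subtractf sum_distrib_left[symmetric]
          sum_distrib_right[symmetric])
    show ?thesis unfolding ex by (simp add: field_simps power2_eq_square)
  qed
  also have "\<dots> = 4 * real m * (\<Sum>u\<in>vecs k - {?z}. (fourier k h u)\<^sup>2)"
    using sum.remove[OF finite_vecs replicate_in_vecs, of "\<lambda>u. (fourier k h u)\<^sup>2" k False]
    by (simp add: parseval f0)
  also have "\<dots> = (\<Sum>u\<in>vecs k - {?z}. (fourier k h u)\<^sup>2 * (4 * real m))"
    by (simp add: sum_distrib_left mult.commute)
  also have "\<dots> \<le> (\<Sum>u\<in>vecs k - {?z}. (fourier k h u)\<^sup>2 * (\<Sum>a\<in>I. (1 - chi u (s a))\<^sup>2))"
    unfolding cnt using gap by (intro sum_mono mult_left_mono) auto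
  also have "\<dots> \<le> (\<Sum>u\<in>vecs k. (fourier k h u)\<^sup>2 * (\<Sum>a\<in>I. (1 - chi u (s a))\<^sup>2))"
    by (rule sum_mono2) (auto intro!: mult_nonneg_nonneg sum_nonneg)
  also have "\<dots> = (\<Sum>a\<in>I. \<Sum>u\<in>vecs k. (fourier k h u)\<^sup>2 * (1 - chi u (s a))\<^sup>2)"
    unfolding sum_distrib_left by (rule sum.swap)
  also have "\<dots> = (\<Sum>a\<in>I. 2 ^ k * (\<Sum>v\<in>vecs k. (h v - h (vadd v (s a)))\<^sup>2))"
    by (rule sum.cong) (simp_all only: one)
  finally show ?thesis by (simp add: sum_distrib_left[symmetric])
qed

section \<open>The state space\<close>

lemma step_in_tuples:
  assumes "y \<in> tuples (vecs k) n" "a < n" "b < n"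
  shows "step y a b \<in> tuples (vecs k) n"
proof -
  have "y ! a \<in> vecs k" "y ! b \<in> vecs k" using assms by (auto simp: tuples_def)
  then have "vadd (y ! b) (y ! a) \<in> vecs k" by simp
  then show ?thesis using assms set_update_subset_insert[of y b "vadd (y ! b) (y ! a)"]
    by (auto simp: step_def tuples_def)
qed

text \<open>As \<open>a\<close> and \<open>b\<close> differ, the added vector survives the move and
  cancels when added again. Each move is thus an involution, which makes the kernel
  symmetric.\<close>

lemma step_step:
  assumes "y \<in> tuples (vecs k) n" "a < n" "b < n" "a \<noteq> b"
  shows "step (step y a b) a b = y"
proof -
  have "y ! a \<in> vecs k" "y ! b \<in> vecs k" using assms by (auto simp: tuples_def)
  then show ?thesis using assms by (simp add: step_def tuples_def vecs_def)
qed

section \<open>Linear spans and invariance of the spanning tuples\<close>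

lemma lincomb_Cons [simp]:
  "lincomb k (c # cs) (z # zs) = (if c then vadd z (lincomb k cs zs) else lincomb k cs zs)"
  "lincomb k [] zs = replicate k False"
  by (auto simp: lincomb_def)

lemma lincomb_in_vecs:
  "\<lbrakk>length cs = length zs; set zs \<subseteq> vecs k\<rbrakk> \<Longrightarrow> lincomb k cs zs \<in> vecs k"
  by (induction cs zs rule: list_induct2) auto

lemma lincomb_add:
  "\<lbrakk>length cs = length zs; length ds = length zs; set zs \<subseteq> vecs k\<rbrakk> \<Longrightarrow>
    vadd (lincomb k cs zs) (lincomb k ds zs) = lincomb k (vadd cs ds) zs"
proof (induction cs zs arbitrary: ds rule: list_induct2)
  case Nil
  then show ?case by (simp add: vadd_zero)
next
  case (Cons c cs z zs)
  then obtain d ds' where ds: "ds = d # ds'" "length ds' = length zs" by (cases ds) auto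
  have IH: "vadd (lincomb k cs zs) (lincomb k ds' zs) = lincomb k (vadd cs ds') zs"
    using Cons ds by auto
  have l: "length z = k" "length (lincomb k cs zs) = k" "length (lincomb k ds' zs) = k"
    using Cons ds lincomb_in_vecs[of cs zs k] lincomb_in_vecs[of ds' zs k] by (auto simp: vecs_def)
  have [simp]: "vadd z (vadd z x) = x" if "length x = k" for x
    using that l by (metis vadd_cancel vadd_commute)
  have "vadd (lincomb k cs zs) (vadd z (lincomb k ds' zs))
      = vadd z (vadd (lincomb k cs zs) (lincomb k ds' zs))"
    by (metis vadd_assoc vadd_commute)
  then show ?case using l by (simp add: ds IH vadd_assoc flip: IH)
qed

lemma nth_in_span2:
  "\<lbrakk>i < length zs; set zs \<subseteq> vecs k\<rbrakk> \<Longrightarrow> zs ! i \<in> span2 k zs"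
proof (induction zs arbitrary: i)
  case (Cons z zs)
  have z: "\<exists>ds. length ds = length zs \<and> lincomb k ds zs = replicate k False"
    by (rule exI[of _ "replicate (length zs) False"]) (induction zs; simp)
  show ?case
  proof (cases i)
    case 0
    obtain ds where "length ds = length zs" "lincomb k ds zs = replicate k False" using z by auto
    then show ?thesis using 0 Cons.prems
      by (auto simp: span2_def vecs_def vadd_zero intro!: exI[of _ "True # ds"])
  next
    case (Suc j)
    then obtain ds where "length ds = length zs" "zs ! j = lincomb k ds zs"
      using Cons by (auto simp: span2_def)
    then show ?thesis using Suc by (auto simp: span2_def intro!: exI[of _ "False # ds"])
  qed
qed simp

lemma zero_in_span2: "replicate k False \<in> span2 k zs"
proof -
  have "lincomb k (replicate (length zs) False) zs = replicate k False"
    by (induction zs) auto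
  then show ?thesis
    by (auto simp: span2_def intro!: exI[of _ "replicate (length zs) False"])
qed

lemma vadd_in_span2:
  assumes "set zs \<subseteq> vecs k" "u \<in> span2 k zs" "v \<in> span2 k zs"
  shows "vadd u v \<in> span2 k zs"
proof -
  obtain cs ds where "length cs = length zs" "u = lincomb k cs zs"
    "length ds = length zs" "v = lincomb k ds zs" using assms by (auto simp: span2_def)
  then show ?thesis using lincomb_add[of cs zs ds k] assms
    by (auto simp: span2_def intro!: exI[of _ "vadd cs ds"])
qed

lemma span2_subset:
  assumes zs: "set zs \<subseteq> vecs k" and sub: "set ys \<subseteq> span2 k zs"
  shows "span2 k ys \<subseteq> span2 k zs"
proof -
  have "lincomb k cs ys \<in> span2 k zs" if "length cs = length ys" for cs
    using that sub
    by (induction cs ys rule: list_induct2) (auto intro: zero_in_span2 vadd_in_span2[OF zs])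
  then show ?thesis by (auto simp: span2_def[of k ys])
qed

lemma St_alt: "St n k = {zs \<in> tuples (vecs k) n. span2 k zs = vecs k}"
  by (auto simp: St_def tuples_def vecs_def)

text \<open>By the involution, the old entry at \<open>b\<close> is the sum of two entries of the
  new tuple, so no vector of the span is lost.\<close>

lemma step_in_St:
  assumes y: "y \<in> St n k" and ab: "a < n" "b < n" "a \<noteq> b"
  shows "step y a b \<in> St n k"
proof -
  let ?y = "step y a b"
  have yt: "y \<in> tuples (vecs k) n" using y by (simp add: St_alt)
  then have yt': "?y \<in> tuples (vecs k) n" using ab by (simp add: step_in_tuples)
  have sub: "set y \<subseteq> span2 k ?y"
  proof
    fix z assume "z \<in> set y"
    then obtain i where i: "i < n" "z = y ! i" using yt by (auto simp: in_set_conv_nth tuples_def)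
    have sp: "?y ! j \<in> span2 k ?y" if "j < n" for j
      using that yt' by (intro nth_in_span2) (auto simp: tuples_def)
    show "z \<in> span2 k ?y"
    proof (cases "i = b")
      case True
      have "step ?y a b ! b = vadd (?y ! b) (?y ! a)"
        using ab yt' by (simp add: step_def tuples_def)
      then have "z = vadd (?y ! b) (?y ! a)" using step_step[OF yt ab] i True by simp
      moreover have "vadd (?y ! b) (?y ! a) \<in> span2 k ?y"
        using yt' sp ab by (intro vadd_in_span2) (auto simp: tuples_def)
      ultimately show ?thesis by simp
    next
      case False
      then have "?y ! i = z" using i by (simp add: step_def)
      then show ?thesis using sp[OF i(1)] by simp
    qed
  qed
  have "vecs k \<subseteq> span2 k ?y"
    using span2_subset[OF _ sub] yt' y by (auto simp: St_alt tuples_def)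
  moreover have "span2 k ?y \<subseteq> vecs k"
    using yt' lincomb_in_vecs by (auto simp: span2_def tuples_def)
  ultimately show ?thesis using yt' by (simp add: St_alt)
qed

definition wt :: "bool list \<Rightarrow> bool list list \<Rightarrow> nat" where
  "wt u y = card {a. a < length y \<and> dot u (y ! a)}"

text \<open>A functional vanishing on all entries vanishes on their span, hence everywhere, and is
  then zero. This keeps the weight chain off the absorbing value 0.\<close>

lemma wt_pos:
  assumes y: "y \<in> St n k" and u: "u \<in> vecs k" "u \<noteq> replicate k False"
  shows "wt u y > 0"
proof (rule ccontr)
  assume "\<not> wt u y > 0"
  then have orth: "\<forall>z\<in>set y. \<not> dot u z"
    by (auto simp: wt_def in_set_conv_nth)
  have yv: "set y \<subseteq> vecs k" using y by (auto simp: St_alt tuples_def)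
  have "\<not> dot u (lincomb k cs y)" if "length cs = length y" for cs
    using that orth yv
  proof (induction cs y rule: list_induct2)
    case (Cons c cs z zs)
    then have "length z = length (lincomb k cs zs)"
      using lincomb_in_vecs[of cs zs k] by (auto simp: vecs_def)
    then show ?case using Cons by (auto simp: dot_vadd)
  qed simp
  then have "\<not> dot u v" if "v \<in> span2 k y" for v
    using that by (auto simp: span2_def)
  then have "\<not> dot u v" if "v \<in> vecs k" for v
    using y that by (auto simp: St_alt)
  then show False using dot_nondegenerate[OF u] by metis
qed

section \<open>Entropy decay\<close>

definition pairs :: "nat \<Rightarrow> (nat \<times> nat) set" where
  "pairs n = {(a, b). a < n \<and> b < n \<and> a \<noteq> b}"

text \<open>The half-lazy step acting on laws: since moves are involutions, the mass arriving at
  \<open>y\<close> by a move comes from \<open>step y a b\<close>.\<close>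

definition qstep :: "nat \<Rightarrow> (bool list list \<Rightarrow> real) \<Rightarrow> bool list list \<Rightarrow> real" where
  "qstep n p y = p y / 2 + (\<Sum>(a, b)\<in>pairs n. p (step y a b)) / (2 * real (n * (n - 1)))"

lemma pairs_alt: "pairs n = Sigma {..<n} (\<lambda>a. {..<n} - {a})"
  by (auto simp: pairs_def)

lemma finite_pairs [simp]: "finite (pairs n)"
  by (simp add: pairs_alt)

lemma card_pairs [simp]: "card (pairs n) = n * (n - 1)"
  by (simp add: pairs_alt card_SigmaI)

lemma sum_pairs: "(\<Sum>(a, b)\<in>pairs n. F a b) = (\<Sum>b<n. \<Sum>a\<in>{..<n} - {b}. F a b)"
proof -
  have "(\<Sum>(a, b)\<in>pairs n. F a b) = (\<Sum>(b, a)\<in>Sigma {..<n} (\<lambda>b. {..<n} - {b}). F a b)"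
    by (rule sum.reindex_bij_witness[of _ prod.swap prod.swap]) (auto simp: pairs_def)
  then show ?thesis by (simp add: sum.Sigma)
qed

section \<open>Conservation of mass and dissipation of entropy in one step\<close>

lemma sum_step:
  assumes "(a, b) \<in> pairs n"
  shows "(\<Sum>y\<in>tuples (vecs k) n. F (step y a b)) = (\<Sum>y\<in>tuples (vecs k) n. F y)"
  by (rule sum.reindex_bij_witness[of _ "\<lambda>y. step y a b" "\<lambda>y. step y a b"])
    (use assms in \<open>auto simp: pairs_def step_in_tuples step_step\<close>)

lemma sum_qstep:
  assumes n: "n \<ge> 2"
  shows "(\<Sum>y\<in>tuples (vecs k) n. qstep n p y) = (\<Sum>y\<in>tuples (vecs k) n. p y)"
proof -
  let ?T = "tuples (vecs k) n"
  have "(\<Sum>y\<in>?T. \<Sum>(a, b)\<in>pairs n. p (step y a b)) = (\<Sum>(a, b)\<in>pairs n. \<Sum>y\<in>?T. p (step y a b))"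
    by (subst sum.swap) (simp add: case_prod_beta)
  also have "\<dots> = (\<Sum>(a, b)\<in>pairs n. \<Sum>y\<in>?T. p y)"
    by (rule sum.cong) (auto simp: sum_step)
  also have "\<dots> = real (n * (n - 1)) * sum p ?T" by (simp add: case_prod_beta)
  finally show ?thesis using n
    by (simp add: qstep_def sum.distrib sum_divide_distrib[symmetric] del: of_nat_mult)
qed

text \<open>Jensen's inequality with a remainder. Laziness lets \<open>qstep n p y\<close> be read
  as the average over moves \<open>e\<close> of \<open>(p y + q e) / 2\<close>; the tangent bound at
  this average is used for \<open>p y\<close> and for each \<open>q e\<close>, and its linear terms
  sum to zero.\<close>

lemma entropy_qstep_pointwise:
  assumes n: "n \<ge> 2" and py: "p y \<ge> 0" and ps: "\<And>a b. (a, b) \<in> pairs n \<Longrightarrow> p (step y a b) \<ge> 0"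
  shows "qstep n p y * ln (qstep n p y)
      + (\<Sum>(a, b)\<in>pairs n. (sqrt (p y) - sqrt (p (step y a b)))\<^sup>2) / (4 * real (n * (n - 1)))
    \<le> qstep n (\<lambda>y. p y * ln (p y)) y"
proof -
  define A where "A = qstep n p y"
  define M where "M = real (n * (n - 1))"
  define q where "q = (\<lambda>(a, b). p (step y a b))"
  have M: "M > 0" using n by (simp add: M_def)
  have q0: "q e \<ge> 0" if "e \<in> pairs n" for e using ps that by (cases e) (auto simp: q_def)
  have cM: "real (card (pairs n)) = M" by (simp add: M_def)
  have A: "A = p y / 2 + sum q (pairs n) / (2 * M)"
    by (simp add: A_def qstep_def M_def q_def)
  have R: "qstep n (\<lambda>y. p y * ln (p y)) y = p y * ln (p y) / 2 + (\<Sum>e\<in>pairs n. q e * ln (q e)) / (2 * M)"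
    by (simp add: qstep_def M_def q_def case_prod_beta)
  have E: "(\<Sum>(a, b)\<in>pairs n. (sqrt (p y) - sqrt (p (step y a b)))\<^sup>2) = (\<Sum>e\<in>pairs n. (sqrt (p y) - sqrt (q e))\<^sup>2)"
    by (simp add: q_def case_prod_beta)
  have q_sum: "sum q (pairs n) \<ge> 0" using q0 by (rule sum_nonneg)
  show ?thesis
  proof (cases "A = 0")
    case True
    then have "p y = 0" "sum q (pairs n) = 0"
      using A py q_sum M by (auto simp: field_simps add_nonneg_eq_0_iff)
    then have "p y = 0" "\<And>e. e \<in> pairs n \<Longrightarrow> q e = 0"
      using q0 by (auto simp: sum_nonneg_eq_0_iff)
    then show ?thesis using True unfolding R E A_def[symmetric] by simp
  next
    case False
    then have A0: "A > 0" using A py q_sum M by (simp add: less_le)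
    have pt: "(p y + q e) / 2 - A + (sqrt (p y) - sqrt (q e))\<^sup>2 / 4
        \<le> (p y * ln (p y) + q e * ln (q e)) / 2 - (p y + q e) / 2 * ln A" if e: "e \<in> pairs n" for e
    proof -
      \<comment> \<open>The right side is smallest at the midpoint of \<open>x\<close> and
        \<open>z\<close>, where equality holds; so the unknown average \<open>A\<close> drops out of
        the remainder.\<close>
      have "(x - z)\<^sup>2 / 4 \<le> ((x - c)\<^sup>2 + (z - c)\<^sup>2) / 2" for x z c :: real
        using zero_le_power2[of "x + z - 2 * c"] by (simp add: power2_eq_square field_simps)
      then have "(sqrt (p y) - sqrt (q e))\<^sup>2 / 4 \<le> ((sqrt (p y) - sqrt A)\<^sup>2 + (sqrt (q e) - sqrt A)\<^sup>2) / 2" .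
      moreover have "(p y + q e) / 2 * ln A = p y * ln A / 2 + q e * ln A / 2"
        by (simp add: field_simps)
      ultimately show ?thesis
        using entropy_tangent[OF py A0] entropy_tangent[OF q0[OF e] A0] by argo
    qed
    have avg: "(\<Sum>e\<in>pairs n. (p y + q e) / 2) = M * A"
      using M by (simp add: A sum.distrib sum_divide_distrib[symmetric] cM field_simps del: card_pairs)
    have "(\<Sum>e\<in>pairs n. (p y + q e) / 2 - A + (sqrt (p y) - sqrt (q e))\<^sup>2 / 4)
      \<le> (\<Sum>e\<in>pairs n. (p y * ln (p y) + q e * ln (q e)) / 2 - (p y + q e) / 2 * ln A)"
      by (intro sum_mono pt)
    also have "(\<Sum>e\<in>pairs n. (p y + q e) / 2 - A + (sqrt (p y) - sqrt (q e))\<^sup>2 / 4)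
       = (\<Sum>e\<in>pairs n. (sqrt (p y) - sqrt (q e))\<^sup>2) / 4"
      unfolding sum.distrib sum_subtractf avg by (simp add: cM sum_divide_distrib del: card_pairs)
    also have "(\<Sum>e\<in>pairs n. (p y * ln (p y) + q e * ln (q e)) / 2 - (p y + q e) / 2 * ln A)
       = M * (p y * ln (p y)) / 2 + (\<Sum>e\<in>pairs n. q e * ln (q e)) / 2 - M * A * ln A"
      unfolding sum_subtractf sum_distrib_right[symmetric] avg
      by (simp add: sum.distrib sum_divide_distrib[symmetric] cM add_divide_distrib del: card_pairs)
    finally have "(\<Sum>e\<in>pairs n. (sqrt (p y) - sqrt (q e))\<^sup>2) / 4 / M
       \<le> (M * (p y * ln (p y)) / 2 + (\<Sum>e\<in>pairs n. q e * ln (q e)) / 2 - M * A * ln A) / M"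
      using M by (intro divide_right_mono) auto
    then show ?thesis
      unfolding R E A_def[symmetric] M_def[symmetric] using M
      by (simp add: add_divide_distrib diff_divide_distrib)
  qed
qed

lemma uent_qstep:
  assumes n: "n \<ge> 2" and p: "\<And>y. y \<in> tuples (vecs k) n \<Longrightarrow> p y \<ge> 0"
  shows "uent (tuples (vecs k) n) (qstep n p)
     + (\<Sum>y\<in>tuples (vecs k) n. \<Sum>(a, b)\<in>pairs n. (sqrt (p y) - sqrt (p (step y a b)))\<^sup>2) / (4 * real (n * (n - 1)))
    \<le> uent (tuples (vecs k) n) p"
proof -
  let ?T = "tuples (vecs k) n"
  have "(\<Sum>y\<in>?T. qstep n p y * ln (qstep n p y)
      + (\<Sum>(a, b)\<in>pairs n. (sqrt (p y) - sqrt (p (step y a b)))\<^sup>2) / (4 * real (n * (n - 1))))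
    \<le> (\<Sum>y\<in>?T. qstep n (\<lambda>y. p y * ln (p y)) y)"
    by (intro sum_mono entropy_qstep_pointwise n p) (auto simp: pairs_def step_in_tuples)
  then show ?thesis
    unfolding uent_def sum_qstep[OF n] by (simp add: sum.distrib sum_divide_distrib)
qed

section \<open>Entropy against the Dirichlet form\<close>

text \<open>The bound on the weight is not strict: a weight above \<open>m\<close> leaves at least
  \<open>m\<close> coordinates once the coordinate \<open>b\<close> is omitted.\<close>

definition unbalanced :: "nat \<Rightarrow> nat \<Rightarrow> bool list list \<Rightarrow> bool" where
  "unbalanced k m y \<longleftrightarrow> (\<exists>u\<in>vecs k. u \<noteq> replicate k False \<and> wt u y \<le> m)"

text \<open>After tensorization, each fibre in direction \<open>b\<close> is treated separately:
  logarithmic Sobolev and Poincare inequalities where the other coordinates generate well, and the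
  maximal entropy \<open>ln N\<close> times the mass elsewhere.\<close>

lemma uent_le_dirichlet:
  assumes n: "n \<ge> 2" and m: "m > 0" and p: "\<And>y. y \<in> tuples (vecs k) n \<Longrightarrow> p y \<ge> 0"
  defines "K \<equiv> 5 + 8 * ln (2 ^ k :: real)"
  shows "uent (tuples (vecs k) n) p
    \<le> K / (4 * real m) * (\<Sum>y\<in>tuples (vecs k) n. \<Sum>(a, b)\<in>pairs n. (sqrt (p y) - sqrt (p (step y a b)))\<^sup>2)
      + real n * ln (2 ^ k) * (\<Sum>y | y \<in> tuples (vecs k) n \<and> unbalanced k m y. p y)"
proof -
  let ?T = "tuples (vecs k) n"
  let ?V = "vecs k"
  define N where "N = (2 ^ k :: real)"
  define good where "good b y \<longleftrightarrow> (\<forall>u\<in>?V. u \<noteq> replicate k False \<longrightarrow> m \<le> card {a\<in>{..<n} - {b}. dot u (y ! a)})"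
    for b and y :: "bool list list"
  define B where "B b y = (if good b y then 0 else p y)" for b y
  define D where "D b y = (\<Sum>a\<in>{..<n} - {b}. (sqrt (p y) - sqrt (p (step y a b)))\<^sup>2)" for b y
  have N: "N \<ge> 1" by (simp add: N_def)
  have lN: "ln N \<ge> 0" using N by simp
  have K: "K > 0" using lN by (simp add: K_def N_def add_pos_nonneg)
  have fT: "finite ?T" by (simp add: finite_tuples)
  have upd: "y[b := v] \<in> ?T" if "y \<in> ?T" "v \<in> ?V" for y b v
    using that set_update_subset_insert[of y b v] by (auto simp: tuples_def)
  \<comment> \<open>Goodness ignores coordinate \<open>b\<close>, so it is constant along the fibre
    and the case distinction is legitimate.\<close>
  have good_upd: "good b (y[b := v]) = good b y" for b y v
  proof -
    have "{a\<in>{..<n} - {b}. dot u (y[b := v] ! a)} = {a\<in>{..<n} - {b}. dot u (y ! a)}" for u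
      by auto
    then show ?thesis unfolding good_def by simp
  qed
  have pt: "uent ?V (\<lambda>v. p (y[b := v]))
      \<le> K / (4 * real m) * (\<Sum>v\<in>?V. D b (y[b := v])) + ln N * (\<Sum>v\<in>?V. B b (y[b := v]))"
    if y: "y \<in> ?T" and b: "b < n" for y b
  proof (cases "good b y")
    case True
    let ?h = "\<lambda>v. sqrt (p (y[b := v]))"
    have ly: "length y = n" using y by (simp add: tuples_def)
    have "uent ?V (\<lambda>v. p (y[b := v])) = uent ?V (\<lambda>v. (?h v)\<^sup>2)"
      unfolding uent_def using p upd[OF y] by (intro arg_cong2[where f = "(-)"] sum.cong
          arg_cong2[where f = "(*)"] arg_cong[where f = ln]) auto
    also have "\<dots> \<le> K * (\<Sum>v\<in>?V. (?h v - sum ?h ?V / 2 ^ k)\<^sup>2)"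
      using uent_square_le_variance[of ?V ?h] p upd[OF y] by (simp add: K_def)
    also have "\<dots> = K / (4 * real m) * (4 * real m * (\<Sum>v\<in>?V. (?h v - sum ?h ?V / 2 ^ k)\<^sup>2))"
      using m by simp
    also have "\<dots> \<le> K / (4 * real m) * (\<Sum>a\<in>{..<n} - {b}. \<Sum>v\<in>?V. (?h v - ?h (vadd v (y ! a)))\<^sup>2)"
      using True y K by (intro mult_left_mono poincare_cayley) (auto simp: good_def tuples_def)
    also have "(\<Sum>a\<in>{..<n} - {b}. \<Sum>v\<in>?V. (?h v - ?h (vadd v (y ! a)))\<^sup>2) = (\<Sum>v\<in>?V. D b (y[b := v]))"
      unfolding D_def using b ly
      by (subst sum.swap) (intro sum.cong, auto simp: step_def)
    also have "(\<Sum>v\<in>?V. B b (y[b := v])) = 0"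
      using True by (simp add: B_def good_upd)
    then have "K / (4 * real m) * (\<Sum>v\<in>?V. D b (y[b := v])) = K / (4 * real m) * (\<Sum>v\<in>?V. D b (y[b := v])) + ln N * (\<Sum>v\<in>?V. B b (y[b := v]))"
      by simp
    finally show ?thesis .
  next
    case False
    have "uent ?V (\<lambda>v. p (y[b := v])) \<le> (\<Sum>v\<in>?V. p (y[b := v])) * ln (real (card ?V))"
      by (rule uent_le) (auto intro!: p upd[OF y])
    also have "\<dots> = ln N * (\<Sum>v\<in>?V. B b (y[b := v]))"
      using False by (simp add: B_def good_upd N_def)
    also have "\<dots> \<le> K / (4 * real m) * (\<Sum>v\<in>?V. D b (y[b := v])) + \<dots>"
      using K m by (auto simp: D_def intro!: sum_nonneg mult_nonneg_nonneg divide_nonneg_nonneg)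
    finally show ?thesis .
  qed
  have "N * uent ?T p \<le> (\<Sum>b<n. \<Sum>y\<in>?T. uent ?V (\<lambda>v. p (y[b := v])))"
    using uent_tensorization[of ?V n p] p by (simp add: N_def)
  also have "\<dots> \<le> (\<Sum>b<n. \<Sum>y\<in>?T. K / (4 * real m) * (\<Sum>v\<in>?V. D b (y[b := v])) + ln N * (\<Sum>v\<in>?V. B b (y[b := v])))"
    by (intro sum_mono pt) auto
  \<comment> \<open>Resampling the b-th entry yields a factor \<open>N\<close>, which cancels the
    one from tensorization.\<close>
  also have "\<dots> = (\<Sum>b<n. K / (4 * real m) * (N * (\<Sum>y\<in>?T. D b y)) + ln N * (N * (\<Sum>y\<in>?T. B b y)))"
    by (rule sum.cong) (simp_all add: sum.distrib sum_distrib_left[symmetric] sum_divide_distrib[symmetric] sum_tuples_resample N_def)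
  also have "\<dots> = N * (K / (4 * real m) * (\<Sum>b<n. \<Sum>y\<in>?T. D b y) + ln N * (\<Sum>b<n. \<Sum>y\<in>?T. B b y))"
  proof -
    have "(\<Sum>b<n. \<alpha> * (N * d b) + \<beta> * (N * e b)) = N * (\<alpha> * sum d {..<n} + \<beta> * sum e {..<n})"
      for \<alpha> \<beta> :: real and d e
      by (simp add: sum.distrib sum_distrib_left distrib_left mult_ac)
    then show ?thesis .
  qed
  finally have main: "uent ?T p \<le> K / (4 * real m) * (\<Sum>b<n. \<Sum>y\<in>?T. D b y) + ln N * (\<Sum>b<n. \<Sum>y\<in>?T. B b y)"
    using N by simp
  have "(\<Sum>y\<in>?T. B b y) \<le> (\<Sum>y | y \<in> ?T \<and> unbalanced k m y. p y)" if b: "b < n" for b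
  proof -
    have "unbalanced k m y" if y: "y \<in> ?T" and ng: "\<not> good b y" for y
    proof -
      obtain u where u: "u \<in> ?V" "u \<noteq> replicate k False" "card {a\<in>{..<n} - {b}. dot u (y ! a)} < m"
        using ng by (auto simp: good_def not_le)
      have "{a. a < length y \<and> dot u (y ! a)} \<subseteq> insert b {a\<in>{..<n} - {b}. dot u (y ! a)}"
        using y by (auto simp: tuples_def)
      then have "wt u y \<le> card (insert b {a\<in>{..<n} - {b}. dot u (y ! a)})"
        unfolding wt_def by (rule card_mono[rotated]) auto
      also have "\<dots> \<le> m" using u(3) by (simp add: card_insert_if)
      finally show ?thesis using u by (auto simp: unbalanced_def)
    qed
    then have "(\<Sum>y\<in>?T. B b y) \<le> (\<Sum>y\<in>?T. if unbalanced k m y then p y else 0)"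
      using p by (intro sum_mono) (auto simp: B_def)
    also have "\<dots> = (\<Sum>y | y \<in> ?T \<and> unbalanced k m y. p y)"
      using fT by (simp add: sum.inter_filter)
    finally show ?thesis .
  qed
  then have "(\<Sum>b<n. \<Sum>y\<in>?T. B b y) \<le> (\<Sum>b<n. \<Sum>y | y \<in> ?T \<and> unbalanced k m y. p y)"
    by (intro sum_mono) auto
  then have B: "ln N * (\<Sum>b<n. \<Sum>y\<in>?T. B b y) \<le> ln N * (real n * (\<Sum>y | y \<in> ?T \<and> unbalanced k m y. p y))"
    using lN by (intro mult_left_mono) auto
  have D: "(\<Sum>b<n. \<Sum>y\<in>?T. D b y) = (\<Sum>y\<in>?T. \<Sum>(a, b)\<in>pairs n. (sqrt (p y) - sqrt (p (step y a b)))\<^sup>2)"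
    unfolding D_def sum_pairs by (rule sum.swap)
  have c: "real n * ln (2 ^ k) * s = ln N * (real n * s)" for s by (simp add: N_def)
  show ?thesis using main B unfolding D c by linarith
qed

text \<open>The rate is chosen so that \<open>\<rho> * K / (4 * m)\<close> equals
  \<open>1 / (4 * n * (n - 1))\<close>, the coefficient of the Dirichlet form in the one-step
  dissipation.\<close>

lemma uent_contraction:
  assumes n: "n \<ge> 2" and m: "m > 0" and p: "\<And>y. y \<in> tuples (vecs k) n \<Longrightarrow> p y \<ge> 0"
  defines "\<rho> \<equiv> real m / (real (n * (n - 1)) * (5 + 8 * ln (2 ^ k)))"
  shows "uent (tuples (vecs k) n) (qstep n p) \<le> (1 - \<rho>) * uent (tuples (vecs k) n) p
    + \<rho> * (real n * ln (2 ^ k) * (\<Sum>y | y \<in> tuples (vecs k) n \<and> unbalanced k m y. p y))"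
proof -
  let ?T = "tuples (vecs k) n"
  define K where "K = 5 + 8 * ln (2 ^ k :: real)"
  define M where "M = real (n * (n - 1))"
  define E where "E = (\<Sum>y\<in>?T. \<Sum>(a, b)\<in>pairs n. (sqrt (p y) - sqrt (p (step y a b)))\<^sup>2)"
  define X where "X = real n * ln (2 ^ k) * (\<Sum>y | y \<in> ?T \<and> unbalanced k m y. p y)"
  have pos: "K > 0" "M > 0" using n by (simp_all add: K_def M_def add_pos_nonneg)
  have r: "\<rho> = real m / (M * K)" by (simp add: \<rho>_def M_def K_def)
  have "\<rho> * (uent ?T p - X) \<le> \<rho> * (K / (4 * real m) * E)"
    using uent_le_dirichlet[where k = k and p = p, OF n m p] pos
    by (intro mult_left_mono) (auto simp: r K_def E_def X_def)
  also have "\<dots> = E / (4 * M)" using pos m by (simp add: r field_simps)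
  also have "\<dots> \<le> uent ?T p - uent ?T (qstep n p)"
    using uent_qstep[where k = k and p = p, OF n p] by (simp add: E_def M_def)
  finally show ?thesis by (simp add: X_def algebra_simps)
qed

section \<open>Weights of linear functionals\<close>

text \<open>Only the value of the functional at \<open>b\<close> can change, and it flips exactly if
  the value at \<open>a\<close> is nonzero. The truncated subtraction is exact, since in that case
  the weight is positive.\<close>

lemma wt_step:
  assumes y: "y \<in> tuples (vecs k) n" and ab: "a < n" "b < n" "a \<noteq> b"
  shows "wt u (step y a b) = (if \<not> dot u (y ! a) then wt u y
    else if dot u (y ! b) then wt u y - 1 else wt u y + 1)"
proof -
  define I where "I = {i. i < n \<and> dot u (y ! i)}"
  have ly: "length y = n" using y by (simp add: tuples_def)
  have [simp]: "finite I" by (simp add: I_def)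
  have "y ! a \<in> vecs k" "y ! b \<in> vecs k" using assms by (auto simp: tuples_def)
  then have d: "dot u (vadd (y ! b) (y ! a)) = (dot u (y ! b) \<noteq> dot u (y ! a))"
    by (intro dot_vadd) (simp add: vecs_def)
  have "{i. i < n \<and> dot u (step y a b ! i)} = (if \<not> dot u (y ! a) then I
      else if dot u (y ! b) then I - {b} else insert b I)"
    using ab ly d by (auto simp: I_def step_def nth_list_update)
  moreover have "wt u (step y a b) = card {i. i < n \<and> dot u (step y a b ! i)}"
    by (simp add: wt_def step_def ly)
  moreover have "wt u y = card I" by (simp add: wt_def I_def ly)
  moreover have "b \<in> I \<longleftrightarrow> dot u (y ! b)" using ab by (simp add: I_def)
  ultimately show ?thesis by (simp add: card_Diff_singleton)
qed

text \<open>Count of moves: \<open>a\<close> must lie in the support of the functional; then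
  \<open>n - w\<close> choices of \<open>b\<close> raise the weight and \<open>w - 1\<close> lower
  it.\<close>

lemma sum_pairs_wt:
  fixes \<phi> :: "nat \<Rightarrow> real" and u :: "bool list"
  assumes y: "y \<in> tuples (vecs k) n"
  defines "w \<equiv> wt u y"
  shows "(\<Sum>(a, b)\<in>pairs n. \<phi> (wt u (step y a b)) - \<phi> w)
    = real w * ((real n - real w) * (\<phi> (w + 1) - \<phi> w) + (real w - 1) * (\<phi> (w - 1) - \<phi> w))"
proof -
  define I where "I = {i. i < n \<and> dot u (y ! i)}"
  have ly: "length y = n" using y by (simp add: tuples_def)
  have fI [simp]: "finite I" by (simp add: I_def)
  have In: "I \<subseteq> {..<n}" by (auto simp: I_def)
  have w: "w = card I" by (simp add: w_def wt_def I_def ly)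
  have wn: "w \<le> n" using card_mono[OF _ In] by (simp add: w)
  let ?X = "\<phi> (w + 1) - \<phi> w" and ?Y = "\<phi> (w - 1) - \<phi> w"
  have row: "(\<Sum>b\<in>{..<n} - {a}. \<phi> (wt u (step y a b)) - \<phi> w)
      = (if a \<in> I then (real n - real w) * ?X + (real w - 1) * ?Y else 0)" if a: "a < n" for a
  proof (cases "a \<in> I")
    case False
    then show ?thesis using a by (auto simp: wt_step[OF y] I_def w_def intro!: sum.neutral)
  next
    case True
    have split: "{..<n} - {a} = (I - {a}) \<union> ({..<n} - I)" using True In by auto
    have "(\<Sum>b\<in>{..<n} - {a}. \<phi> (wt u (step y a b)) - \<phi> w)
      = (\<Sum>b\<in>I - {a}. \<phi> (wt u (step y a b)) - \<phi> w) + (\<Sum>b\<in>{..<n} - I. \<phi> (wt u (step y a b)) - \<phi> w)"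
      unfolding split by (rule sum.union_disjoint) auto
    also have "(\<Sum>b\<in>I - {a}. \<phi> (wt u (step y a b)) - \<phi> w) = (\<Sum>b\<in>I - {a}. ?Y)"
      by (rule sum.cong) (use True in \<open>auto simp: wt_step[OF y] I_def w_def\<close>)
    also have "(\<Sum>b\<in>{..<n} - I. \<phi> (wt u (step y a b)) - \<phi> w) = (\<Sum>b\<in>{..<n} - I. ?X)"
    proof (rule sum.cong)
      fix b assume b: "b \<in> {..<n} - I"
      then have "a \<noteq> b" using True by auto
      then show "\<phi> (wt u (step y a b)) - \<phi> w = ?X"
        using True b by (simp add: wt_step[OF y] I_def w_def)
    qed simp
    also have "(\<Sum>b\<in>I - {a}. ?Y) = (real w - 1) * ?Y"
    proof -
      have "w \<ge> 1" using True fI by (metis w card_gt_0_iff empty_iff One_nat_def Suc_leI)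
      then show ?thesis using True by (simp add: w card_Diff_singleton of_nat_diff)
    qed
    also have "(\<Sum>b\<in>{..<n} - I. ?X) = (real n - real w) * ?X"
      using wn In by (simp add: card_Diff_subset w[symmetric] of_nat_diff)
    finally show ?thesis using True by simp
  qed
  have "(\<Sum>(a, b)\<in>pairs n. \<phi> (wt u (step y a b)) - \<phi> w)
      = (\<Sum>a<n. \<Sum>b\<in>{..<n} - {a}. \<phi> (wt u (step y a b)) - \<phi> w)"
    by (simp add: pairs_alt sum.Sigma)
  also have "\<dots> = (\<Sum>a<n. if a \<in> I then (real n - real w) * ?X + (real w - 1) * ?Y else 0)"
    by (rule sum.cong) (simp_all add: row)
  also have "\<dots> = (\<Sum>a\<in>{..<n} \<inter> I. (real n - real w) * ?X + (real w - 1) * ?Y)"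
    by (rule sum.inter_restrict[symmetric]) simp
  also have "{..<n} \<inter> I = I" using In by auto
  finally show ?thesis by (simp add: w)
qed

section \<open>A Lyapunov function for the weight chain\<close>

text \<open>The Lyapunov function: \<open>1 / w\<close> decreases at rate of order \<open>1 / n\<close> already from weight 1,
  and beyond \<open>m\<close> it is continued geometrically, with matching difference at \<open>m\<close>, so that the
  weights above \<open>n / 6\<close>, where the drift may be positive, contribute an exponentially small error.\<close>

definition phi :: "nat \<Rightarrow> nat \<Rightarrow> real" where
  "phi m w = (if w < m then 1 / real w - 1 / real m + 1 / (real m * (real m - 1))
     else (1 / 2) ^ (w - m) / (real m * (real m - 1)))"

lemma phi_ge:
  assumes "m \<ge> 2" "w \<ge> 1" "w \<le> m"
  shows "1 / (real m * (real m - 1)) \<le> phi m w"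
proof (cases "w = m")
  case False
  have "1 / real m \<le> 1 / real w" using assms by (intro divide_left_mono) auto
  then show ?thesis using False assms by (simp add: phi_def)
qed (simp add: phi_def)

lemma phi_nonneg:
  assumes "m \<ge> 2" "w \<ge> 1"
  shows "phi m w \<ge> 0"
proof (cases "w \<le> m")
  case True
  have "0 \<le> 1 / (real m * (real m - 1))" using assms by simp
  also have "\<dots> \<le> phi m w" using assms True by (intro phi_ge)
  finally show ?thesis .
qed (use assms in \<open>simp add: phi_def\<close>)

lemma phi_le:
  assumes "m \<ge> 2" "w \<ge> 1" "w < m"
  shows "phi m w \<le> 1 / real w"
proof -
  have "1 / (real m * (real m - 1)) \<le> 1 / (real m * 1)"
    using assms by (intro divide_left_mono mult_left_mono) auto
  then show ?thesis using assms by (simp add: phi_def)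
qed

lemma phi_le_1:
  assumes "m \<ge> 2" "w \<ge> 1"
  shows "phi m w \<le> 1"
proof (cases "w < m")
  case True
  then have "phi m w \<le> 1 / real w" using assms by (intro phi_le) auto
  also have "\<dots> \<le> 1" using assms by simp
  finally show ?thesis .
next
  case False
  have "real m * (real m - 1) \<ge> 1 * 1" using assms by (intro mult_mono) auto
  moreover have "(1 / 2 :: real) ^ (w - m) \<le> 1" by (simp add: power_le_one)
  ultimately show ?thesis using False by (simp add: phi_def divide_le_eq)
qed

lemma phi_Suc_below:
  assumes "m \<ge> 2" "w < m"
  shows "phi m (w + 1) = 1 / real (w + 1) - 1 / real m + 1 / (real m * (real m - 1))"
proof (cases "w + 1 < m")
  case False
  then have "w + 1 = m" using assms by simp
  then show ?thesis by (simp add: phi_def)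
qed (simp add: phi_def)

text \<open>The geometric rule extends down to \<open>w = m\<close> because
  \<open>1 / (m - 1) - 1 / m\<close> is \<open>1 / (m * (m - 1))\<close>, the value of
  \<open>phi\<close> at \<open>m\<close>.\<close>

lemma phi_pred_above:
  assumes "m \<ge> 2" "m \<le> w"
  shows "phi m (w - 1) = 2 * phi m w"
proof (cases "w = m")
  case True
  then show ?thesis using assms by (simp add: phi_def of_nat_diff field_simps)
next
  case False
  then have "w - m = Suc (w - 1 - m)" "m \<le> w - 1" using assms by auto
  then show ?thesis using assms by (simp add: phi_def)
qed

lemma phi_drift:
  assumes m: "m \<ge> 2" and mn: "12 * m \<le> n" and w: "1 \<le> w" "w \<le> n"
  shows "real w * ((real n - real w) * (phi m (w + 1) - phi m w) + (real w - 1) * (phi m (w - 1) - phi m w))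
    \<le> - ((real n - 1) / 4 * phi m w) + 2 * (real n)\<^sup>2 * ((1 / 2) ^ m / (real m * (real m - 1)))"
    (is "?L \<le> ?R1 + ?err")
proof -
  have err: "?err \<ge> 0" using m by auto
  have p0: "phi m w \<ge> 0" using m w by (simp add: phi_nonneg)
  \<comment> \<open>Below \<open>m\<close> the drift of \<open>1 / w\<close> is computed exactly. On
    the middle range a step up halves \<open>phi\<close> and a step down doubles it. Above
    \<open>n / 6\<close> no decay is claimed and everything goes into the error.\<close>
  consider "w < m" | "m \<le> w" "6 * w \<le> n" | "6 * w > n" by linarith
  then show ?thesis
  proof cases
    case 1
    have up: "phi m (w + 1) - phi m w = 1 / (real w + 1) - 1 / real w"
      using m 1 by (simp add: phi_Suc_below) (simp add: phi_def)
    have down: "(real w - 1) * (phi m (w - 1) - phi m w) \<le> 1 / real w"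
    proof (cases "w = 1")
      case False
      then have "w \<ge> 2" using w by simp
      then have "phi m (w - 1) - phi m w = 1 / (real w - 1) - 1 / real w"
        using 1 by (simp add: phi_def of_nat_diff)
      then show ?thesis using \<open>w \<ge> 2\<close> by (simp add: field_simps)
    qed simp
    have "?L \<le> real w * ((real n - real w) * (1 / (real w + 1) - 1 / real w) + 1 / real w)"
      unfolding up using down by (intro mult_left_mono) auto
    also have "\<dots> = - (real n - 2 * real w - 1) / (real w + 1)"
    proof -
      have "r * ((N - r) * (1 / (r + 1) - 1 / r) + 1 / r) = - (N - 2 * r - 1) / (r + 1)"
        if "r > 0" for r N :: real
      proof -
        define i j where "i = 1 / (r + 1)" and "j = 1 / r"
        have ri: "r * i = 1 - i" and rj: "r * j = 1"
          using that by (simp_all add: i_def j_def field_simps)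
        have "r * ((N - r) * (i - j) + j) = (N - r) * (r * i - r * j) + r * j"
          by (simp add: algebra_simps)
        also have "\<dots> = - (N - r) * i + (r * i + i)" by (simp add: ri rj) (simp add: algebra_simps)
        also have "\<dots> = - (N - 2 * r - 1) * i" by (simp add: algebra_simps)
        also have "\<dots> = - (N - 2 * r - 1) / (r + 1)" by (simp add: i_def)
        finally have "r * ((N - r) * (i - j) + j) = - (N - 2 * r - 1) / (r + 1)" .
        then show ?thesis by (simp only: i_def j_def)
      qed
      then show ?thesis using w by simp
    qed
    \<comment> \<open>Here \<open>4 * w + 1 <= n\<close> bounds the numerator and
      \<open>w >= 1\<close> the denominator.\<close>
    also have "\<dots> \<le> - ((real n - 1) / 2) / (real w + real w)"
    proof -
      have "4 * w + 1 \<le> n" using 1 mn by linarith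
      then have "real (4 * w + 1) \<le> real n" by (simp only: of_nat_le_iff)
      then have "real n - 2 * real w - 1 \<ge> (real n - 1) / 2" by simp
      moreover have "(real n - 1) / 2 \<ge> 0" using w by simp
      ultimately have "((real n - 1) / 2) / (real w + real w) \<le> (real n - 2 * real w - 1) / (real w + 1)"
        using w by (intro frac_le) auto
      then show ?thesis by (simp only: minus_divide_left[symmetric] neg_le_iff_le)
    qed
    also have "\<dots> = - ((real n - 1) / 4 * (1 / real w))" using w by (simp add: field_simps)
    also have "\<dots> \<le> - ((real n - 1) / 4 * phi m w)"
      using phi_le[OF m w(1) 1] w by (intro le_imp_neg_le mult_left_mono) auto
    finally show ?thesis using err by linarith
  next
    case 2
    have up: "phi m (w + 1) = phi m w / 2" using phi_pred_above[of m "w + 1"] m 2 by simp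
    have "?L = - (real w * phi m w * ((real n - 3 * real w + 2) / 2))"
      unfolding up phi_pred_above[OF m 2(1)] by (simp add: field_simps)
    also have "\<dots> \<le> - (1 * phi m w * ((real n - 1) / 4))"
      using p0 w 2 by (intro le_imp_neg_le mult_mono) auto
    also have "\<dots> = - ((real n - 1) / 4 * phi m w)" by simp
    finally show ?thesis using err by linarith
  next
    case 3
    then have wm: "2 * m \<le> w" using mn by simp
    then have "m \<le> w" by simp
    have up: "phi m (w + 1) = phi m w / 2" using phi_pred_above[of m "w + 1"] m wm by simp
    have "?L \<le> real w * (0 + (real w - 1) * phi m w)"
      unfolding up phi_pred_above[OF m \<open>m \<le> w\<close>] using w p0
      by (intro mult_left_mono add_mono) (auto simp: mult_nonneg_nonpos)
    also have "\<dots> \<le> real n * (real n * phi m w)"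
      using w p0 by (intro mult_mono) (auto intro!: mult_right_mono)
    finally have "?L \<le> real n * (real n * phi m w)" .
    moreover have "(real n - 1) / 4 * phi m w \<le> real n * 1 * phi m w"
      using p0 by (intro mult_right_mono) auto
    ultimately have "?L - ?R1 \<le> real n * (real n * phi m w) + real n * 1 * phi m w"
      by linarith
    also have "\<dots> \<le> real n * (real n * phi m w) + real n * real n * phi m w"
      using w p0 by (intro add_left_mono mult_right_mono mult_left_mono) auto
    also have "\<dots> = 2 * (real n)\<^sup>2 * phi m w" by (simp add: power2_eq_square)
    also have "\<dots> \<le> ?err"
    proof -
      \<comment> \<open>From \<open>6 * w > n >= 12 * m\<close> one has \<open>w >= 2 * m\<close>,
        so at least \<open>m\<close> halvings have occurred.\<close>
      have "(1 / 2 :: real) ^ (w - m) \<le> (1 / 2) ^ m" using wm by (intro power_decreasing) auto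
      then have "phi m w \<le> (1 / 2) ^ m / (real m * (real m - 1))"
        using wm m by (simp add: phi_def divide_right_mono)
      then show ?thesis by (intro mult_left_mono) auto
    qed
    finally show ?thesis by simp
  qed
qed

text \<open>Reversibility moves the step from the law to the observable \<open>F\<close>, leaving
  its expected increment.\<close>

lemma sum_qstep_mult:
  assumes n: "n \<ge> 2"
  shows "(\<Sum>y\<in>tuples (vecs k) n. qstep n p y * F y)
    = (\<Sum>y\<in>tuples (vecs k) n. p y *
        (F y + (\<Sum>(a, b)\<in>pairs n. F (step y a b) - F y) / (2 * real (n * (n - 1)))))"
proof -
  let ?T = "tuples (vecs k) n"
  define M where "M = real (n * (n - 1))"
  have M: "M > 0" using n by (simp add: M_def)
  have cM: "real (card (pairs n)) = M" by (simp add: M_def)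
  have sw: "(\<Sum>y\<in>?T. p (step y a b) * F y) = (\<Sum>y\<in>?T. p y * F (step y a b))"
    if "(a, b) \<in> pairs n" for a b
    using sum_step[OF that, of "\<lambda>y. p (step y a b) * F y" k] that
    by (auto simp: pairs_def step_step intro!: sum.cong)
  have swap: "(\<Sum>y\<in>?T. \<Sum>e\<in>pairs n. p (step y (fst e) (snd e)) * F y)
      = (\<Sum>y\<in>?T. \<Sum>e\<in>pairs n. p y * F (step y (fst e) (snd e)))"
    by (subst (1 2) sum.swap) (rule sum.cong, auto simp: sw)
  have "(\<Sum>y\<in>?T. qstep n p y * F y)
      = (\<Sum>y\<in>?T. p y * F y) / 2 + (\<Sum>y\<in>?T. \<Sum>e\<in>pairs n. p (step y (fst e) (snd e)) * F y) / (2 * M)"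
    unfolding qstep_def M_def[symmetric]
    by (simp add: case_prod_beta distrib_right sum.distrib sum_distrib_right sum_divide_distrib)
  also have "\<dots> = (\<Sum>y\<in>?T. p y * F y / 2 + p y * (\<Sum>e\<in>pairs n. F (step y (fst e) (snd e))) / (2 * M))"
    unfolding swap by (simp add: sum.distrib sum_divide_distrib sum_distrib_left)
  also have "\<dots> = (\<Sum>y\<in>?T. p y * (F y + (\<Sum>(a, b)\<in>pairs n. F (step y a b) - F y) / (2 * M)))"
    using M by (intro sum.cong refl) (simp add: case_prod_beta sum_subtractf cM field_simps del: card_pairs)
  finally show ?thesis by (simp add: M_def)
qed

text \<open>\<open>B\<close> is the fixed point of the affine map, and the distance to it contracts
  by \<open>1 - r\<close>.\<close>

lemma linear_recurrence_le:
  fixes x :: "nat \<Rightarrow> real"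
  assumes "0 \<le> r" "r \<le> 1" "0 \<le> B" and step: "\<And>t. x (Suc t) \<le> (1 - r) * x t + r * B"
  shows "x t \<le> (1 - r) ^ t * x 0 + B"
proof (induction t)
  case (Suc t)
  have "x (Suc t) \<le> (1 - r) * x t + r * B" by (rule step)
  also have "\<dots> \<le> (1 - r) * ((1 - r) ^ t * x 0 + B) + r * B"
    using assms Suc by (intro add_right_mono mult_left_mono) auto
  finally show ?case by (simp add: algebra_simps)
qed (use assms in simp)

section \<open>The law of the chain\<close>

lemma finite_St [simp]: "finite (St n k)"
  by (rule finite_subset[of _ "tuples (vecs k) n"]) (auto simp: St_alt finite_tuples)

lemma Qker_outside: "w \<in> St n k \<Longrightarrow> y \<notin> St n k \<Longrightarrow> Qker n w y = 0"
proof -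
  assume w: "w \<in> St n k" and y: "y \<notin> St n k"
  then have none: "{(a, b). a < n \<and> b < n \<and> a \<noteq> b \<and> step w a b = y} = {}"
    by (auto dest: step_in_St)
  have "Pker n w y = 0" unfolding Pker_def none by simp
  then show ?thesis using w y by (auto simp: Qker_def)
qed

lemma Qpow_outside: "x \<in> St n k \<Longrightarrow> y \<notin> St n k \<Longrightarrow> Qpow n k t x y = 0"
  by (cases t) (auto simp: Qker_outside)

lemma Qpow_nonneg: "Qpow n k t x y \<ge> 0"
  by (induction t arbitrary: y) (auto intro!: sum_nonneg mult_nonneg_nonneg simp: Qker_def Pker_def)

text \<open>By the involution, \<open>step w a b = y\<close> means \<open>w = step y a b\<close>, so
  summing over predecessors becomes averaging over moves from \<open>y\<close>. Predecessors outside
  \<open>St n k\<close> carry no mass.\<close>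

lemma Qpow_Suc_qstep:
  assumes x: "x \<in> St n k" and y: "y \<in> tuples (vecs k) n"
  shows "Qpow n k (Suc t) x y = qstep n (Qpow n k t x) y"
proof -
  define M where "M = real (n * (n - 1))"
  let ?p = "Qpow n k t x"
  have invol: "step w (fst e) (snd e) = y \<longleftrightarrow> w = step y (fst e) (snd e)"
    if "w \<in> St n k" "e \<in> pairs n" for w e
    using that y step_step[of w k n "fst e" "snd e"] step_step[of y k n "fst e" "snd e"]
    by (auto simp: pairs_def St_alt)
  have P: "Pker n w y = (\<Sum>(a, b)\<in>pairs n. if w = step y a b then 1 else 0) / M" if w: "w \<in> St n k" for w
  proof -
    have "{(a, b). a < n \<and> b < n \<and> a \<noteq> b \<and> step w a b = y} = {e \<in> pairs n. step w (fst e) (snd e) = y}"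
      by (auto simp: pairs_def)
    also have "\<dots> = {e \<in> pairs n. w = step y (fst e) (snd e)}"
      using invol[OF w] by blast
    finally have eq: "{(a, b). a < n \<and> b < n \<and> a \<noteq> b \<and> step w a b = y} = {e \<in> pairs n. w = step y (fst e) (snd e)}" .
    show ?thesis
      unfolding Pker_def M_def[symmetric] eq by (simp add: case_prod_beta sum.inter_filter[symmetric])
  qed
  have pick: "(\<Sum>w\<in>St n k. ?p w * (if w = z then 1 else 0)) = ?p z" for z
    using Qpow_outside[OF x, of z t] by (simp add: if_distrib sum.delta cong: if_cong)
  have "Qpow n k (Suc t) x y = (\<Sum>w\<in>St n k. ?p w * (if w = y then 1 else 0)) / 2
      + (\<Sum>w\<in>St n k. \<Sum>e\<in>pairs n. ?p w * (if w = step y (fst e) (snd e) then 1 else 0)) / (2 * M)"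
  proof -
    have "?p w * Qker n w y = ?p w * (if w = y then 1 else 0) / 2
        + (\<Sum>e\<in>pairs n. ?p w * (if w = step y (fst e) (snd e) then 1 else 0)) / (2 * M)"
      if "w \<in> St n k" for w
      by (simp only: Qker_def P[OF that] sum_distrib_left[symmetric] case_prod_beta)
        (simp add: field_simps case_prod_beta)
    then show ?thesis by (simp only: Qpow.simps sum.distrib sum_divide_distrib cong: sum.cong)
  qed
  also have "(\<Sum>w\<in>St n k. \<Sum>e\<in>pairs n. ?p w * (if w = step y (fst e) (snd e) then 1 else 0))
      = (\<Sum>e\<in>pairs n. ?p (step y (fst e) (snd e)))"
    by (subst sum.swap) (simp only: pick)
  finally show ?thesis unfolding pick qstep_def M_def by (simp add: case_prod_beta)
qed

lemma sum_Qpow: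
  assumes n: "n \<ge> 2" and x: "x \<in> St n k"
  shows "(\<Sum>y\<in>tuples (vecs k) n. Qpow n k t x y) = 1"
proof (induction t)
  case 0
  then show ?case using x by (simp add: St_alt finite_tuples)
next
  case (Suc t)
  have "(\<Sum>y\<in>tuples (vecs k) n. Qpow n k (Suc t) x y) = (\<Sum>y\<in>tuples (vecs k) n. qstep n (Qpow n k t x) y)"
    by (rule sum.cong) (simp_all only: Qpow_Suc_qstep[OF x])
  then show ?case using Suc sum_qstep[OF n] by simp
qed

section \<open>Probability of unbalanced states\<close>

text \<open>The law charges only spanning tuples, whose weights are at least 1, so the drift bound
  applies and gives an affine recurrence for the expectation.\<close>

lemma expectation_phi_le:
  assumes m: "m \<ge> 2" and mn: "12 * m \<le> n" and x: "x \<in> St n k"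
    and u: "u \<in> vecs k" "u \<noteq> replicate k False"
  shows "(\<Sum>y\<in>tuples (vecs k) n. Qpow n k t x y * phi m (wt u y))
    \<le> (1 - 1 / (8 * real n)) ^ t + 16 * real n * ((1 / 2) ^ m / (real m * (real m - 1)))"
proof -
  let ?T = "tuples (vecs k) n"
  define e where "e = (1 / 2) ^ m / (real m * (real m - 1))"
  define X where "X t = (\<Sum>y\<in>?T. Qpow n k t x y * phi m (wt u y))" for t
  have n: "n \<ge> 2" using m mn by simp
  have e0: "e \<ge> 0" using m by (simp add: e_def)
  have step: "X (Suc t) \<le> (1 - 1 / (8 * real n)) * X t + 1 / (8 * real n) * (16 * real n * e)" for t
  proof -
    have pt: "Qpow n k t x y * (phi m (wt u y)
          + (\<Sum>(a, b)\<in>pairs n. phi m (wt u (step y a b)) - phi m (wt u y)) / (2 * real (n * (n - 1))))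
        \<le> Qpow n k t x y * ((1 - 1 / (8 * real n)) * phi m (wt u y) + 2 * e)" if y: "y \<in> ?T" for y
    proof (cases "y \<in> St n k")
      case False
      then show ?thesis using Qpow_outside[OF x] by simp
    next
      case True
      define w where "w = wt u y"
      have w1: "1 \<le> w" using wt_pos[OF True u] by (simp add: w_def)
      have wn: "w \<le> n"
      proof -
        have "w \<le> card {..<n}" unfolding w_def wt_def
          using y by (intro card_mono) (auto simp: tuples_def)
        then show ?thesis by simp
      qed
      have "(\<Sum>(a, b)\<in>pairs n. phi m (wt u (step y a b)) - phi m w)
          \<le> - ((real n - 1) / 4 * phi m w) + 2 * (real n)\<^sup>2 * e"
        unfolding w_def sum_pairs_wt[OF y] unfolding w_def[symmetric] e_def
        by (rule phi_drift[OF m mn w1 wn])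
      then have "(\<Sum>(a, b)\<in>pairs n. phi m (wt u (step y a b)) - phi m w) / (2 * real (n * (n - 1)))
          \<le> (- ((real n - 1) / 4 * phi m w) + 2 * (real n)\<^sup>2 * e) / (2 * real (n * (n - 1)))"
        by (intro divide_right_mono) auto
      \<comment> \<open>Dividing by \<open>2 * n * (n - 1)\<close> produces the rate
        \<open>1 / (8 * n)\<close>. The error, at most \<open>2 * e\<close>, is this rate times
        \<open>16 * n * e\<close>.\<close>
      also have "\<dots> = - (1 / (8 * real n)) * phi m w + real n / (real n - 1) * e"
        using n by (simp add: of_nat_diff power2_eq_square field_simps)
      also have "\<dots> \<le> - (1 / (8 * real n)) * phi m w + 2 * e"
        using n e0 by (intro add_left_mono mult_right_mono) (auto simp: field_simps)
      finally show ?thesis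
        unfolding w_def[symmetric] by (intro mult_left_mono Qpow_nonneg) (simp add: algebra_simps)
    qed
    have "X (Suc t) = (\<Sum>y\<in>?T. qstep n (Qpow n k t x) y * phi m (wt u y))"
      unfolding X_def by (rule sum.cong) (simp_all only: Qpow_Suc_qstep[OF x])
    also have "\<dots> \<le> (\<Sum>y\<in>?T. Qpow n k t x y * ((1 - 1 / (8 * real n)) * phi m (wt u y) + 2 * e))"
      unfolding sum_qstep_mult[OF n] by (intro sum_mono pt)
    also have "\<dots> = (1 - 1 / (8 * real n)) * X t + 2 * e * (\<Sum>y\<in>?T. Qpow n k t x y)"
      by (simp add: X_def distrib_left sum.distrib sum_distrib_left mult_ac)
    finally show ?thesis using n by (simp add: sum_Qpow[OF n x])
  qed
  have "X t \<le> (1 - 1 / (8 * real n)) ^ t * X 0 + 16 * real n * e"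
    by (rule linear_recurrence_le) (use step n e0 in auto)
  also have "X 0 \<le> 1"
  proof -
    have xT: "x \<in> ?T" using x by (simp add: St_alt)
    have "X 0 = phi m (wt u x)"
      using xT by (simp add: X_def finite_tuples if_distrib[of "\<lambda>c. c * _"] cong: if_cong)
    then show ?thesis using phi_le_1[OF m, of "wt u x"] wt_pos[OF x u] by simp
  qed
  then have "(1 - 1 / (8 * real n)) ^ t * X 0 + 16 * real n * e \<le> (1 - 1 / (8 * real n)) ^ t + 16 * real n * e"
    using n by (intro add_right_mono mult_left_le) (auto simp: field_simps)
  finally show ?thesis by (simp add: X_def e_def)
qed

text \<open>Markov's inequality for \<open>phi\<close>, which is at least \<open>1 / c\<close> up to
  weight \<open>m\<close>, followed by a union bound over fewer than \<open>2 ^ k\<close>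
  functionals.\<close>

lemma unbalanced_probability_le:
  assumes m: "m \<ge> 2" and mn: "12 * m \<le> n" and x: "x \<in> St n k"
  shows "(\<Sum>y | y \<in> tuples (vecs k) n \<and> unbalanced k m y. Qpow n k t x y)
    \<le> 2 ^ k * ((real n)\<^sup>2 * (1 - 1 / (8 * real n)) ^ t + 16 * real n * (1 / 2) ^ m)"
proof -
  let ?T = "tuples (vecs k) n"
  let ?U = "vecs k - {replicate k False}"
  define c where "c = real m * (real m - 1)"
  define R where "R = (real n)\<^sup>2 * (1 - 1 / (8 * real n)) ^ t + 16 * real n * (1 / 2) ^ m"
  have n: "n \<ge> 2" using m mn by simp
  have c: "c > 0" using m by (simp add: c_def)
  have cn: "c \<le> (real n)\<^sup>2" unfolding c_def power2_eq_square using m mn by (intro mult_mono) auto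
  have q0: "0 \<le> 1 - 1 / (8 * real n)" using n by (simp add: field_simps)
  have R0: "R \<ge> 0" unfolding R_def using q0 by simp
  have each: "(\<Sum>y | y \<in> ?T \<and> wt u y \<le> m. Qpow n k t x y) \<le> R" if u: "u \<in> ?U" for u
  proof -
    have u': "u \<in> vecs k" "u \<noteq> replicate k False" using u by auto
    have "(\<Sum>y | y \<in> ?T \<and> wt u y \<le> m. Qpow n k t x y)
        \<le> (\<Sum>y | y \<in> ?T \<and> wt u y \<le> m. c * (Qpow n k t x y * phi m (wt u y)))"
    proof (rule sum_mono)
      fix y assume y: "y \<in> {y \<in> ?T. wt u y \<le> m}"
      show "Qpow n k t x y \<le> c * (Qpow n k t x y * phi m (wt u y))"
      proof (cases "y \<in> St n k")
        case True
        have "1 / c \<le> phi m (wt u y)"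
          unfolding c_def using y wt_pos[OF True u'] m by (intro phi_ge) auto
        then have "1 \<le> c * phi m (wt u y)" using c by (simp add: field_simps)
        then have "Qpow n k t x y * 1 \<le> Qpow n k t x y * (c * phi m (wt u y))"
          by (intro mult_left_mono Qpow_nonneg)
        then show ?thesis by (simp add: mult_ac)
      qed (simp add: Qpow_outside[OF x])
    qed
    also have "\<dots> \<le> (\<Sum>y\<in>?T. c * (Qpow n k t x y * phi m (wt u y)))"
    proof (rule sum_mono2)
      \<comment> \<open>The added terms have weight above \<open>m\<close>; at weight 0, where
        \<open>1 / 0 = 0\<close>, \<open>phi\<close> may be negative.\<close>
      fix y assume "y \<in> ?T - {y \<in> ?T. wt u y \<le> m}"
      then have "phi m (wt u y) \<ge> 0" using m by (intro phi_nonneg) auto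
      then show "0 \<le> c * (Qpow n k t x y * phi m (wt u y))" using c Qpow_nonneg by simp
    qed (auto simp: finite_tuples)
    also have "\<dots> = c * (\<Sum>y\<in>?T. Qpow n k t x y * phi m (wt u y))" by (simp add: sum_distrib_left)
    also have "\<dots> \<le> c * ((1 - 1 / (8 * real n)) ^ t + 16 * real n * ((1 / 2) ^ m / c))"
      unfolding c_def using c
      by (intro mult_left_mono expectation_phi_le m mn x u') (simp add: c_def)
    also have "\<dots> = c * (1 - 1 / (8 * real n)) ^ t + 16 * real n * (1 / 2) ^ m"
      using c by (simp add: field_simps)
    also have "\<dots> \<le> R" unfolding R_def using cn q0 by (intro add_right_mono mult_right_mono) auto
    finally show ?thesis .
  qed
  have fT: "finite ?T" by (simp add: finite_tuples)
  have "(\<Sum>y | y \<in> ?T \<and> unbalanced k m y. Qpow n k t x y)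
      = (\<Sum>y\<in>?T. if unbalanced k m y then Qpow n k t x y else 0)"
    using fT by (simp add: sum.inter_filter)
  also have "\<dots> \<le> (\<Sum>y\<in>?T. \<Sum>u\<in>?U. if wt u y \<le> m then Qpow n k t x y else 0)"
  proof (rule sum_mono)
    fix y
    show "(if unbalanced k m y then Qpow n k t x y else 0)
        \<le> (\<Sum>u\<in>?U. if wt u y \<le> m then Qpow n k t x y else 0)"
    proof (cases "unbalanced k m y")
      case True
      then obtain u where u: "u \<in> ?U" "wt u y \<le> m" by (auto simp: unbalanced_def)
      show ?thesis
        using member_le_sum[OF u(1), of "\<lambda>u. if wt u y \<le> m then Qpow n k t x y else 0"] u True
        by (simp add: Qpow_nonneg)
    next
      case False
      have "0 \<le> (\<Sum>u\<in>?U. if wt u y \<le> m then Qpow n k t x y else 0)"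
        by (rule sum_nonneg) (simp add: Qpow_nonneg)
      then show ?thesis using False by simp
    qed
  qed
  also have "\<dots> = (\<Sum>u\<in>?U. \<Sum>y | y \<in> ?T \<and> wt u y \<le> m. Qpow n k t x y)"
    using fT by (subst sum.swap) (simp add: sum.inter_filter)
  also have "\<dots> \<le> (\<Sum>u\<in>?U. R)" by (intro sum_mono each)
  also have "\<dots> \<le> (\<Sum>u\<in>vecs k. R)" using R0 by (intro sum_mono2) auto
  finally show ?thesis by (simp add: R_def)
qed

section \<open>Mixing\<close>

lemma power_one_minus_le_exp:
  fixes r :: real
  assumes "r \<le> 1"
  shows "(1 - r) ^ t \<le> exp (- (r * real t))"
proof -
  have "(1 - r) ^ t \<le> exp (- r) ^ t"
    using assms exp_ge_add_one_self[of "- r"] by (intro power_mono) auto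
  then show ?thesis by (simp add: exp_of_nat_mult[symmetric] mult.commute)
qed

text \<open>Passing from the uniform law on all tuples to that on the smaller set
  \<open>St n k\<close> only lowers the relative entropy of a law supported there; the tangent bound
  then controls the Hellinger distance.\<close>

lemma tv_dist_le_quarter:
  assumes n: "n \<ge> 2" and x: "x \<in> St n k"
    and ent: "uent (tuples (vecs k) n) (Qpow n k t x) \<le> 1 / 16"
  shows "tv_dist n k t x \<le> 1 / 4"
proof -
  let ?T = "tuples (vecs k) n"
  let ?p = "Qpow n k t x"
  define q where "q = 1 / real (card (St n k))"
  have sub: "St n k \<subseteq> ?T" by (auto simp: St_alt)
  have fT: "finite ?T" by (simp add: finite_tuples)
  have "card (St n k) \<noteq> 0" using x by (metis card_0_eq empty_iff finite_St)
  then have cS: "real (card (St n k)) > 0" by linarith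
  have q: "q > 0" using cS by (simp add: q_def)
  have sumq: "(\<Sum>y\<in>St n k. q) = 1"
    using cS by (simp only: q_def sum_constant times_divide_eq_right mult_1_right divide_self)
  have restr: "(\<Sum>y\<in>St n k. F (?p y)) = (\<Sum>y\<in>?T. F (?p y))" if "F 0 = 0" for F :: "real \<Rightarrow> real"
    by (rule sum.mono_neutral_left) (use fT sub that Qpow_outside[OF x] in auto)
  have sump: "(\<Sum>y\<in>St n k. ?p y) = 1" using restr[of "\<lambda>r. r"] sum_Qpow[OF n x] by simp
  have "(\<Sum>y\<in>St n k. ?p y - q + (sqrt (?p y) - sqrt q)\<^sup>2) \<le> (\<Sum>y\<in>St n k. ?p y * ln (?p y) - ?p y * ln q)"
    by (intro sum_mono entropy_tangent Qpow_nonneg q)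
  then have "(\<Sum>y\<in>St n k. (sqrt (?p y) - sqrt q)\<^sup>2) \<le> (\<Sum>y\<in>St n k. ?p y * ln (?p y)) - ln q"
    by (simp only: sum.distrib sum_subtractf sump sumq sum_distrib_right[symmetric])
  also have "\<dots> = (\<Sum>y\<in>?T. ?p y * ln (?p y)) + ln (real (card (St n k)))"
    using restr[of "\<lambda>r. r * ln r"] cS by (simp add: q_def ln_div)
  also have "\<dots> \<le> (\<Sum>y\<in>?T. ?p y * ln (?p y)) + ln (real (card ?T))"
    using cS card_mono[OF fT sub] by simp
  also have "\<dots> = uent ?T ?p" by (simp add: uent_def sum_Qpow[OF n x])
  finally have hel: "(\<Sum>y\<in>St n k. (sqrt (?p y) - sqrt q)\<^sup>2) \<le> 1 / 16" using ent by simp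
  \<comment> \<open>Weighted AM-GM on \<open>|a - b| * (a + b)\<close>. The weights give
    \<open>4 / 16 + 2 / 8 = 1 / 2\<close> after summation, hence total variation at most
    \<open>1 / 4\<close>.\<close>
  have pt: "\<bar>?p y - q\<bar> \<le> 4 * (sqrt (?p y) - sqrt q)\<^sup>2 + (?p y + q) / 8" for y
  proof -
    define a b where "a = sqrt (?p y)" and "b = sqrt q"
    have ab: "?p y = a\<^sup>2" "q = b\<^sup>2" "a \<ge> 0" "b \<ge> 0"
      using Qpow_nonneg[of n k t x y] q by (auto simp: a_def b_def)
    have "\<bar>a\<^sup>2 - b\<^sup>2\<bar> = \<bar>a - b\<bar> * (a + b)"
      using ab(3,4) by (simp add: power2_eq_square square_diff_square_factored abs_mult mult.commute)
    also have "\<dots> \<le> 4 * \<bar>a - b\<bar>\<^sup>2 + (a + b)\<^sup>2 / 16"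
      using zero_le_power2[of "2 * \<bar>a - b\<bar> - (a + b) / 4"] unfolding power2_diff
      by (simp add: power_mult_distrib power_divide)
    also have "\<dots> \<le> 4 * (a - b)\<^sup>2 + (a\<^sup>2 + b\<^sup>2) / 8"
      using zero_le_power2[of "a - b"] by (simp add: power2_eq_square field_simps)
    finally show ?thesis unfolding ab(1,2) using ab(3,4) by simp
  qed
  have "(\<Sum>y\<in>St n k. \<bar>?p y - q\<bar>) \<le> (\<Sum>y\<in>St n k. 4 * (sqrt (?p y) - sqrt q)\<^sup>2 + (?p y + q) / 8)"
    by (intro sum_mono pt)
  also have "\<dots> = 4 * (\<Sum>y\<in>St n k. (sqrt (?p y) - sqrt q)\<^sup>2) + 1 / 4"
    by (simp only: sum.distrib sum_distrib_left[symmetric] sum_divide_distrib[symmetric] sump sumq) simp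
  finally show ?thesis using hel by (simp add: tv_dist_def piU_def q_def)
qed

lemma uent_Qpow_contraction:
  assumes n: "n \<ge> 2" and m: "m > 0" and x: "x \<in> St n k"
  defines "\<rho> \<equiv> real m / (real (n * (n - 1)) * (5 + 8 * ln (2 ^ k)))"
  shows "uent (tuples (vecs k) n) (Qpow n k (Suc t) x)
    \<le> (1 - \<rho>) * uent (tuples (vecs k) n) (Qpow n k t x)
      + \<rho> * (real n * ln (2 ^ k) * (\<Sum>y | y \<in> tuples (vecs k) n \<and> unbalanced k m y. Qpow n k t x y))"
proof -
  have "uent (tuples (vecs k) n) (Qpow n k (Suc t) x) = uent (tuples (vecs k) n) (qstep n (Qpow n k t x))"
    unfolding uent_def using Qpow_Suc_qstep[OF x]
    by (simp only: cong: sum.cong)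
  then show ?thesis
    using uent_contraction[where p = "Qpow n k t x" and k = k, OF n m Qpow_nonneg] by (simp add: \<rho>_def)
qed

section \<open>Choice of times and constants\<close>

lemma ln_two_power_le: "ln (2 ^ k :: real) \<le> real k"
proof -
  have "ln (2 ^ k :: real) = real k * ln 2" by (simp add: ln_realpow)
  also have "\<dots> \<le> real k * 1" using ln_2_less_1 by (intro mult_left_mono) auto
  finally show ?thesis by simp
qed

text \<open>The time gives decay \<open>exp (- k) / n ^ 5\<close>: the first factor pays for the
  union bound \<open>2 ^ k\<close>, the second for \<open>n ^ 2\<close> from Markov and
  \<open>n ^ 2\<close> from the prefactor. The stationary error costs \<open>2 ^ k\<close> against
  \<open>(1 / 2) ^ (n div 12)\<close>, affordable since \<open>k <= n / 24\<close>.\<close>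

lemma unbalanced_contribution_small:
  fixes n k t :: nat
  assumes n: "n \<ge> 64" and k: "1 \<le> k" "24 * k \<le> n"
    and small: "16 * real n ^ 3 * 2 powr (1 - real n / 24) \<le> 1 / 64"
    and t: "48 * real n * real k * ln (real n) \<le> real t" and x: "x \<in> St n k"
  shows "real n * ln (2 ^ k) * (\<Sum>y | y \<in> tuples (vecs k) n \<and> unbalanced k (n div 12) y. Qpow n k t x y)
    \<le> 1 / 32"
proof -
  let ?m = "n div 12"
  have m: "?m \<ge> 2" "12 * ?m \<le> n" using n by auto
  have rn: "real n > 0" using n by simp
  have lnn: "ln (real n) \<ge> 1"
  proof -
    have "exp 1 \<le> real n" using exp_le n by linarith
    then show ?thesis using rn by (simp add: ln_ge_iff)
  qed
  have "(1 - 1 / (8 * real n)) ^ t \<le> exp (- (1 / (8 * real n) * real t))"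
    using n by (intro power_one_minus_le_exp) (simp add: field_simps)
  also have "\<dots> \<le> exp (- (real k + 5 * ln (real n)))"
  proof -
    \<comment> \<open>Of the \<open>48 / 8 = 6\<close> copies of \<open>k * ln n\<close>, one
      dominates \<open>k\<close> and five dominate \<open>5 * ln n\<close>.\<close>
    have "1 / (8 * real n) * (48 * real n * real k * ln (real n)) \<le> 1 / (8 * real n) * real t"
      using t by (intro mult_left_mono) auto
    then have "6 * (real k * ln (real n)) \<le> 1 / (8 * real n) * real t" using rn by simp
    moreover have "real k * 1 \<le> real k * ln (real n)" using lnn by (intro mult_left_mono) auto
    moreover have "1 * ln (real n) \<le> real k * ln (real n)" using lnn k by (intro mult_right_mono) auto
    ultimately show ?thesis by simp
  qed
  also have "\<dots> = exp (- real k) * (1 / real n ^ 5)"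
  proof -
    have "exp (5 * ln (real n)) = real n ^ 5"
      using rn exp_of_nat_mult[of 5 "ln (real n)"] by simp
    then show ?thesis by (simp add: exp_diff exp_minus divide_inverse)
  qed
  finally have decay: "(1 - 1 / (8 * real n)) ^ t \<le> exp (- real k) * (1 / real n ^ 5)" .
  have two: "2 ^ k * exp (- real k) \<le> (1 :: real)"
  proof -
    have "(2 :: real) ^ k \<le> exp 1 ^ k" using exp_ge_add_one_self[of 1] by (intro power_mono) auto
    then show ?thesis by (simp add: exp_of_nat_mult[symmetric] exp_minus field_simps)
  qed
  have A: "2 ^ k * ((real n)\<^sup>2 * (1 - 1 / (8 * real n)) ^ t) \<le> 1 / real n ^ 3"
  proof -
    have "2 ^ k * ((real n)\<^sup>2 * (1 - 1 / (8 * real n)) ^ t) \<le> 2 ^ k * ((real n)\<^sup>2 * (exp (- real k) * (1 / real n ^ 5)))"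
      by (intro mult_left_mono decay) auto
    also have "\<dots> = (2 ^ k * exp (- real k)) * (1 / real n ^ 3)"
      using rn by (simp add: power2_eq_square field_simps eval_nat_numeral)
    also have "\<dots> \<le> 1 * (1 / real n ^ 3)" by (intro mult_right_mono two) auto
    finally show ?thesis by simp
  qed
  have B: "2 ^ k * (16 * real n * (1 / 2) ^ ?m) \<le> 16 * real n * 2 powr (1 - real n / 24)"
  proof -
    have "real ?m \<ge> real n / 12 - 1" using real_of_nat_div[of 12 n] by linarith
    moreover have "real k \<le> real n / 24" using k by simp
    ultimately have "real k - real ?m \<le> 1 - real n / 24" by simp
    then have "2 powr (real k - real ?m) \<le> 2 powr (1 - real n / 24)" by (intro powr_mono) auto
    moreover have "2 powr (real k - real ?m) = 2 ^ k * (1 / 2) ^ ?m"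
      by (simp only: powr_diff powr_realpow zero_less_numeral power_divide power_one times_divide_eq_right mult_1_right)
    ultimately have "16 * real n * (2 ^ k * (1 / 2) ^ ?m) \<le> 16 * real n * 2 powr (1 - real n / 24)"
      by (intro mult_left_mono) auto
    then show ?thesis by (simp add: mult_ac)
  qed
  let ?P = "\<Sum>y | y \<in> tuples (vecs k) n \<and> unbalanced k ?m y. Qpow n k t x y"
  have P: "?P \<le> 1 / real n ^ 3 + 16 * real n * 2 powr (1 - real n / 24)"
    using unbalanced_probability_le[OF m x, of t] A B by (simp add: distrib_left)
  have c: "real n * ln (2 ^ k) \<le> real n * real n"
    using ln_two_power_le[of k] k by (intro mult_left_mono) auto
  have P0: "0 \<le> ?P" by (intro sum_nonneg Qpow_nonneg)
  have "real n * ln (2 ^ k) * ?P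
      \<le> real n * real n * (1 / real n ^ 3 + 16 * real n * 2 powr (1 - real n / 24))"
    by (rule mult_mono[OF c P _ P0]) simp
  also have "\<dots> = 1 / real n + 16 * real n ^ 3 * 2 powr (1 - real n / 24)"
    using rn by (simp add: field_simps eval_nat_numeral)
  also have "1 / real n \<le> 1 / 64" using n by (simp add: field_simps)
  finally show ?thesis using small by simp
qed

text \<open>Two phases: after \<open>t\<close> steps unbalanced states have negligible mass at all
  later times, and during the next \<open>s\<close> steps the entropy contracts from at most
  \<open>n * k\<close>.\<close>

lemma mixed_after:
  fixes n k t s :: nat
  assumes n: "n \<ge> 64" and k: "1 \<le> k" "24 * k \<le> n"
    and small: "16 * real n ^ 3 * 2 powr (1 - real n / 24) \<le> 1 / 64"
    and t: "48 * real n * real k * ln (real n) \<le> real t"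
    and s: "936 * real n * real k * ln (real n) \<le> real s"
  shows "mixed n k (t + s)"
  unfolding mixed_def
proof
  fix x assume x: "x \<in> St n k"
  let ?T = "tuples (vecs k) n"
  let ?m = "n div 12"
  define K where "K = 5 + 8 * ln (2 ^ k :: real)"
  define \<rho> where "\<rho> = real ?m / (real (n * (n - 1)) * K)"
  define X where "X i = uent ?T (Qpow n k (t + i) x)" for i
  have n2: "n \<ge> 2" using n by simp
  have m: "?m > 0" using n by simp
  have rn: "real n > 0" using n by simp
  have K: "K \<ge> 1" "K \<le> 13 * real k"
    using ln_two_power_le[of k] k by (auto simp: K_def)
  have M: "real n \<le> real (n * (n - 1))" "real (n * (n - 1)) \<le> real n * real n"
    using n by (auto simp: of_nat_diff)
  have \<rho>0: "\<rho> \<ge> 0" using K by (simp add: \<rho>_def)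
  have \<rho>1: "\<rho> \<le> 1"
  proof -
    have "real ?m \<le> real n" by (simp add: div_le_dividend)
    also have "\<dots> \<le> real (n * (n - 1)) * 1" using M by simp
    also have "\<dots> \<le> real (n * (n - 1)) * K" using K by (intro mult_left_mono) auto
    finally show ?thesis unfolding \<rho>_def by (intro divide_le_eq_1[THEN iffD2]) (use M rn K in auto)
  qed
  \<comment> \<open>\<open>312 = 24 * 13\<close>, from \<open>n div 12 >= n / 24\<close> and
    \<open>K <= 13 * k\<close>.\<close>
  have \<rho>_ge: "\<rho> \<ge> 1 / (312 * real n * real k)"
  proof -
    have a: "real n / 24 \<le> real ?m" using real_of_nat_div[of 12 n] n by linarith
    have b: "real (n * (n - 1)) * K \<le> (real n * real n) * (13 * real k)"
      using M K by (intro mult_mono) auto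
    have c: "0 < real (n * (n - 1)) * K" using M rn K by simp
    have "(real n / 24) / ((real n * real n) * (13 * real k)) \<le> \<rho>"
      unfolding \<rho>_def by (rule frac_le[OF _ a c b]) simp
    then show ?thesis using rn k by (simp add: field_simps)
  qed
  have step: "X (Suc i) \<le> (1 - \<rho>) * X i + \<rho> * (1 / 32)" for i
  proof -
    have "X (Suc i) \<le> (1 - \<rho>) * X i + \<rho> * (real n * ln (2 ^ k) *
        (\<Sum>y | y \<in> ?T \<and> unbalanced k ?m y. Qpow n k (t + i) x y))"
      using uent_Qpow_contraction[OF n2 m x, of "t + i"] by (simp add: X_def \<rho>_def K_def)
    also have "\<dots> \<le> (1 - \<rho>) * X i + \<rho> * (1 / 32)"
      using t by (intro add_left_mono mult_left_mono unbalanced_contribution_small n k small x \<rho>0) auto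
    finally show ?thesis .
  qed
  have X0: "X 0 \<le> real n * real k"
  proof -
    have "X 0 \<le> (\<Sum>y\<in>?T. Qpow n k t x y) * ln (real (card ?T))"
      unfolding X_def using x by (simp, intro uent_le) (auto simp: finite_tuples Qpow_nonneg St_alt)
    also have "\<dots> = real n * ln (2 ^ k)"
      by (simp add: sum_Qpow[OF n2 x] card_tuples ln_realpow)
    also have "\<dots> \<le> real n * real k" by (intro mult_left_mono ln_two_power_le) auto
    finally show ?thesis .
  qed
  have "(1 - \<rho>) ^ s * X 0 \<le> exp (- (3 * ln (real n))) * (real n * real k)"
  proof -
    have "(1 - \<rho>) ^ s \<le> exp (- (\<rho> * real s))" by (rule power_one_minus_le_exp[OF \<rho>1])
    also have "\<dots> \<le> exp (- (3 * ln (real n)))"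
    proof -
      \<comment> \<open>\<open>936 = 3 * 312\<close> makes the decay \<open>1 / n ^ 3\<close>, which
        beats the initial entropy, at most \<open>n ^ 2\<close>.\<close>
      have "1 / (312 * real n * real k) * (936 * real n * real k * ln (real n)) \<le> \<rho> * real s"
        using \<rho>_ge s n by (intro mult_mono \<rho>0) auto
      then show ?thesis using rn k by simp
    qed
    finally have "(1 - \<rho>) ^ s * (real n * real k) \<le> exp (- (3 * ln (real n))) * (real n * real k)"
      by (intro mult_right_mono) auto
    moreover have "(1 - \<rho>) ^ s * X 0 \<le> (1 - \<rho>) ^ s * (real n * real k)"
      using X0 \<rho>1 by (intro mult_left_mono) auto
    ultimately show ?thesis by linarith
  qed
  also have "\<dots> \<le> 1 / real n ^ 3 * (real n * real n)"
  proof -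
    have "exp (3 * ln (real n)) = real n ^ 3"
      using rn exp_of_nat_mult[of 3 "ln (real n)"] by simp
    then have "exp (- (3 * ln (real n))) = 1 / real n ^ 3" by (simp add: exp_minus divide_inverse)
    then show ?thesis using k by (simp add: divide_right_mono mult_left_mono)
  qed
  also have "\<dots> = 1 / real n" using rn by (simp add: field_simps eval_nat_numeral)
  also have "\<dots> \<le> 1 / 64" using n by (simp add: field_simps)
  finally have "(1 - \<rho>) ^ s * X 0 \<le> 1 / 64" .
  \<comment> \<open>In total \<open>1 / 64 + 1 / 32\<close>, below the threshold
    \<open>1 / 16\<close> for total variation \<open>1 / 4\<close>.\<close>
  moreover have "X s \<le> (1 - \<rho>) ^ s * X 0 + 1 / 32"
    by (rule linear_recurrence_le) (use \<rho>0 \<rho>1 step in auto)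
  ultimately show "tv_dist n k (t + s) x \<le> 1 / 4"
    by (intro tv_dist_le_quarter n2 x) (simp add: X_def)
qed

theorem theorem3p5:
  shows "\<exists>\<epsilon>0 C. \<epsilon>0 > 0 \<and> C > 0 \<and> (\<exists>N. \<forall>n\<ge>N. \<forall>k. 1 \<le> k \<and> real k \<le> \<epsilon>0 * real n \<longrightarrow>
            (\<exists>t. mixed n k t) \<and> real (tau_mix n k) \<le> C * real n * real k * ln (real n))"
proof -
  have "eventually (\<lambda>n::nat. 16 * real n ^ 3 * 2 powr (1 - real n / 24) \<le> 1 / 64) at_top"
    by real_asymp
  then obtain N0 where N0: "\<And>n::nat. n \<ge> N0 \<Longrightarrow> 16 * real n ^ 3 * 2 powr (1 - real n / 24) \<le> 1 / 64"
    by (auto simp: eventually_at_top_linorder)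
  have main: "(\<exists>t. mixed n k t) \<and> real (tau_mix n k) \<le> 986 * real n * real k * ln (real n)"
    if n: "n \<ge> max N0 64" and k: "1 \<le> k" "real k \<le> 1 / 24 * real n" for n k
  proof -
    define L where "L = real n * real k * ln (real n)"
    define t where "t = nat \<lceil>48 * L\<rceil>"
    define s where "s = nat \<lceil>936 * L\<rceil>"
    have "exp 1 \<le> real n" using exp_le n by linarith
    then have lnn: "ln (real n) \<ge> 1" using n by (simp add: ln_ge_iff)
    have "1 * 1 * 1 \<le> L" unfolding L_def using n k lnn by (intro mult_mono) auto
    then have L: "L \<ge> 1" by simp
    have "24 * k \<le> n"
    proof -
      have "real (24 * k) \<le> real n" using k by simp
      then show ?thesis by (simp only: of_nat_le_iff)
    qed
    moreover have "48 * L \<le> real t" "936 * L \<le> real s" unfolding t_def s_def using L by linarith+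
    ultimately have mx: "mixed n k (t + s)"
      using n k by (intro mixed_after N0) (auto simp: L_def mult.assoc)
    then have "tau_mix n k \<le> t + s" unfolding tau_mix_def by (rule Least_le)
    then have "real (tau_mix n k) \<le> real t + real s" by linarith
    also have "\<dots> \<le> (48 * L + 1) + (936 * L + 1)" unfolding t_def s_def using L by linarith
    \<comment> \<open>\<open>48 + 936 = 984\<close>; the two units from rounding up are absorbed by
      \<open>L >= 1\<close>.\<close>
    also have "\<dots> \<le> 986 * L" using L by simp
    finally show ?thesis using mx by (auto simp: L_def mult.assoc)
  qed
  show ?thesis
    by (rule exI[of _ "1 / 24"], rule exI[of _ 986], rule conjI, simp, rule conjI, simp,
        rule exI[of _ "max N0 64"], use main in blast)
qed

end
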